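(* The functors $\mathcal{IB}\colon\mathbf{zdK}_*\to\mathbf{iBa}$ and $\mathcal S_*\colon\mathbf{iBa}\to\mathbf{zdK}_*$ (both contravariant) constitute a categorical (dual) equivalence between $\mathbf{zdK}_*$ and $\mathbf{iBa}$, and the functors $\mathcal F\colon\mathbf{iBa}\to\mathbf{gBa}$ and $\mathcal B\colon\mathbf{gBa}\to\mathbf{iBa}$ constitute a categorical equivalence between $\mathbf{iBa}$ and $\mathbf{gBa}$.
   Context: $\mathbf{zdK}_*$: objects are Boolean pointed spaces $(X,* )$, i.e. zero-dimensional compact Hausdorff spaces with a designated point; morphisms are continuous functions preserving the designated point. $\mathbf{iBa}$: objects are idealized Boolean algebras $(B,I)$, with $B$ a Boolean algebra and $I$ a maximal (proper) ideal of $B$; morphisms $(B,I)\to(C,J)$ are Boolean homomorphisms $f\colon B\to C$ with $f^{-1}(J)=I$. $\mathbf{gBa}$: objects are generalized Boolean algebras, i.e. distributive lattices with a designated bottom element $\bot$ such that for all $a,b$ there is $c$ with $c\vee b=a\vee b$ and $c\wedge b=\bot$ (this $c$ is unique and denoted $a\smallsetminus b$); morphisms are lattice homomorphisms preserving $\bot$. $\mathcal S_*(B,I)=(\operatorname{uf}B,\,B\smallsetminus I)$, where $\operatorname{uf}B$ is the Stone space of ultrafilters of $B$; $\mathcal{IB}(X,* )=(\operatorname{clop}X,\{b:*\notin b\})$, where $\operatorname{clop}X$ is the Boolean algebra of clopen subsets; both act on morphisms by inverse image as in Stone duality. $\mathcal F(B,I)=I$, $\mathcal F(f)=f|_I$.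 $\mathcal B(A)=(B_A,A)$, where $B_A=A\cup A'$ with $A'=\{a':a\in A\}$ a disjoint copy of $A$, and Boolean operations extending those of $A$ given by $a_1\vee a_2'=(a_2\smallsetminus a_1)'$, $a_1'\vee a_2'=(a_1\wedge a_2)'$, $a_1\wedge a_2'=a_1\smallsetminus a_2$, $a_1'\wedge a_2'=(a_1\vee a_2)'$, $\lnot a=a'$, $\lnot a'=a$, with bottom $\bot$ and top $\bot'$; on morphisms, $\mathcal B(f)$ extends $f$ by $a'\mapsto f(a)'$. *)

theory Defs
  imports "HOL-Analysis.Analysis"
begin

text \<open>
  All categories below are concrete. Morphisms are extensional functions between underlying sets
  (equal to \<open>undefined\<close> outside the source, as in \<open>HOL-Library.FuncSet\<close>), so that equality of morphisms is
  equality in HOL. Identities are \<open>restrict id\<close> and composition is \<open>compose\<close>.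

  There is no type of all sets in HOL, so a category such as that of pointed Boolean spaces is a
  polymorphic constant: for each type \<open>'a\<close> it yields the category of the objects
  whose underlying set consists of elements of \<open>'a\<close>. Functors may change the type (for instance
  from \<open>'a\<close> to \<open>'a set\<close>), and hence a round trip ends in an instance of the original category
  at another type. Two functors \<open>F : C \<rightarrow> D\<close> and \<open>G : C \<rightarrow> D'\<close>, where \<open>D\<close> and \<open>D'\<close> are instances of the
  same polymorphic category, are compared through the morphisms between objects of \<open>D\<close> and
  objects of \<open>D'\<close>.
\<close>

record ('o, 'a) concrete_cat =
  Ob :: "'o set"
  Pts :: "'o \<Rightarrow> 'a set"
  Hom :: "'o \<Rightarrow> 'o \<Rightarrow> ('a \<Rightarrow> 'a) set"

definition id_mor :: "'a set \<Rightarrow> 'a \<Rightarrow> 'a" where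
  "id_mor A = restrict id A"

definition is_category :: "('o, 'a) concrete_cat \<Rightarrow> bool" where
  "is_category C \<longleftrightarrow>
     (\<forall>X\<in>Ob C. \<forall>Y\<in>Ob C. Hom C X Y \<subseteq> Pts C X \<rightarrow>\<^sub>E Pts C Y) \<and>
     (\<forall>X\<in>Ob C. id_mor (Pts C X) \<in> Hom C X X) \<and>
     (\<forall>X\<in>Ob C. \<forall>Y\<in>Ob C. \<forall>Z\<in>Ob C. \<forall>f\<in>Hom C X Y. \<forall>g\<in>Hom C Y Z.
        compose (Pts C X) g f \<in> Hom C X Z)"

record ('o, 'a, 'p, 'b) fctr =
  on_ob :: "'o \<Rightarrow> 'p"
  on_mor :: "'o \<Rightarrow> 'o \<Rightarrow> ('a \<Rightarrow> 'a) \<Rightarrow> 'b \<Rightarrow> 'b"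

definition is_functor ::
  "('o, 'a) concrete_cat \<Rightarrow> ('p, 'b) concrete_cat \<Rightarrow> ('o, 'a, 'p, 'b) fctr \<Rightarrow> bool" where
  "is_functor C D F \<longleftrightarrow> is_category C \<and> is_category D \<and>
     (\<forall>X\<in>Ob C. on_ob F X \<in> Ob D) \<and>
     (\<forall>X\<in>Ob C. \<forall>Y\<in>Ob C. \<forall>f\<in>Hom C X Y. on_mor F X Y f \<in> Hom D (on_ob F X) (on_ob F Y)) \<and>
     (\<forall>X\<in>Ob C. on_mor F X X (id_mor (Pts C X)) = id_mor (Pts D (on_ob F X))) \<and>
     (\<forall>X\<in>Ob C. \<forall>Y\<in>Ob C. \<forall>Z\<in>Ob C. \<forall>f\<in>Hom C X Y. \<forall>g\<in>Hom C Y Z.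
        on_mor F X Z (compose (Pts C X) g f) =
          compose (Pts D (on_ob F X)) (on_mor F Y Z g) (on_mor F X Y f))"

definition is_contravariant_functor ::
  "('o, 'a) concrete_cat \<Rightarrow> ('p, 'b) concrete_cat \<Rightarrow> ('o, 'a, 'p, 'b) fctr \<Rightarrow> bool" where
  "is_contravariant_functor C D F \<longleftrightarrow> is_category C \<and> is_category D \<and>
     (\<forall>X\<in>Ob C. on_ob F X \<in> Ob D) \<and>
     (\<forall>X\<in>Ob C. \<forall>Y\<in>Ob C. \<forall>f\<in>Hom C X Y. on_mor F X Y f \<in> Hom D (on_ob F Y) (on_ob F X)) \<and>
     (\<forall>X\<in>Ob C. on_mor F X X (id_mor (Pts C X)) = id_mor (Pts D (on_ob F X))) \<and>
     (\<forall>X\<in>Ob C. \<forall>Y\<in>Ob C. \<forall>Z\<in>Ob C. \<forall>f\<in>Hom C X Y. \<forall>g\<in>Hom C Y Z.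
        on_mor F X Z (compose (Pts C X) g f) =
          compose (Pts D (on_ob F Z)) (on_mor F X Y f) (on_mor F Y Z g))"

definition id_fctr :: "('o, 'a, 'o, 'a) fctr" where
  "id_fctr = \<lparr>on_ob = (\<lambda>X. X), on_mor = (\<lambda>X Y f. f)\<rparr>"

definition comp_fctr ::
  "('p, 'b, 'q, 'c) fctr \<Rightarrow> ('o, 'a, 'p, 'b) fctr \<Rightarrow> ('o, 'a, 'q, 'c) fctr" where
  "comp_fctr G F =
     \<lparr>on_ob = (\<lambda>X. on_ob G (on_ob F X)),
      on_mor = (\<lambda>X Y f. on_mor G (on_ob F X) (on_ob F Y) (on_mor F X Y f))\<rparr>"

definition comp_contra ::
  "('p, 'b, 'q, 'c) fctr \<Rightarrow> ('o, 'a, 'p, 'b) fctr \<Rightarrow> ('o, 'a, 'q, 'c) fctr" where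
  "comp_contra G F =
     \<lparr>on_ob = (\<lambda>X. on_ob G (on_ob F X)),
      on_mor = (\<lambda>X Y f. on_mor G (on_ob F Y) (on_ob F X) (on_mor F X Y f))\<rparr>"

text \<open>\<open>H\<close> and \<open>H'\<close> are the sets of morphisms from \<open>A\<close> to \<open>B\<close> and from \<open>B\<close> to \<open>A\<close>.\<close>

definition is_iso ::
  "'a set \<Rightarrow> 'b set \<Rightarrow> ('a \<Rightarrow> 'b) set \<Rightarrow> ('b \<Rightarrow> 'a) set \<Rightarrow> ('a \<Rightarrow> 'b) \<Rightarrow> bool" where
  "is_iso A B H H' f \<longleftrightarrow>
     f \<in> H \<and> (\<exists>g\<in>H'. compose A g f = id_mor A \<and> compose B f g = id_mor B)"

text \<open>
  \<open>H\<close> and \<open>H'\<close> give the morphisms from objects of \<open>D\<close> to objects of \<open>D'\<close> and back.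
\<close>

definition naturally_isomorphic ::
  "('o, 'a) concrete_cat \<Rightarrow> ('p, 'b) concrete_cat \<Rightarrow> ('q, 'c) concrete_cat \<Rightarrow>
   ('p \<Rightarrow> 'q \<Rightarrow> ('b \<Rightarrow> 'c) set) \<Rightarrow> ('q \<Rightarrow> 'p \<Rightarrow> ('c \<Rightarrow> 'b) set) \<Rightarrow>
   ('o, 'a, 'p, 'b) fctr \<Rightarrow> ('o, 'a, 'q, 'c) fctr \<Rightarrow> bool" where
  "naturally_isomorphic C D D' H H' F G \<longleftrightarrow>
     (\<exists>\<eta>. (\<forall>X\<in>Ob C. is_iso (Pts D (on_ob F X)) (Pts D' (on_ob G X))
                      (H (on_ob F X) (on_ob G X)) (H' (on_ob G X) (on_ob F X)) (\<eta> X)) \<and>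
          (\<forall>X\<in>Ob C. \<forall>Y\<in>Ob C. \<forall>f\<in>Hom C X Y.
             compose (Pts D (on_ob F X)) (\<eta> Y) (on_mor F X Y f) =
             compose (Pts D (on_ob F X)) (on_mor G X Y f) (\<eta> X)))"

text \<open>
  \<open>F : C \<rightarrow> D\<close> and \<open>G : D \<rightarrow> C'\<close> are functors with \<open>G \<circ> F\<close> naturally isomorphic to the identity,
  where \<open>C'\<close> is an instance of the same polymorphic category as \<open>C\<close>, and \<open>H\<close>, \<open>H'\<close> are the morphisms
  between objects of \<open>C\<close> and objects of \<open>C'\<close>. Polymorphic functors \<open>F\<close> and \<open>G\<close> form an equivalence if
  this holds for \<open>F\<close> followed by \<open>G\<close> and also for \<open>G\<close> followed by \<open>F\<close>, at every type.
\<close>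

definition left_quasi_inverse ::
  "('o, 'a) concrete_cat \<Rightarrow> ('p, 'b) concrete_cat \<Rightarrow> ('q, 'c) concrete_cat \<Rightarrow>
   ('o \<Rightarrow> 'q \<Rightarrow> ('a \<Rightarrow> 'c) set) \<Rightarrow> ('q \<Rightarrow> 'o \<Rightarrow> ('c \<Rightarrow> 'a) set) \<Rightarrow>
   ('p, 'b, 'q, 'c) fctr \<Rightarrow> ('o, 'a, 'p, 'b) fctr \<Rightarrow> bool" where
  "left_quasi_inverse C D C' H H' G F \<longleftrightarrow>
     is_functor C D F \<and> is_functor D C' G \<and>
     naturally_isomorphic C C C' H H' id_fctr (comp_fctr G F)"

definition contra_left_quasi_inverse ::
  "('o, 'a) concrete_cat \<Rightarrow> ('p, 'b) concrete_cat \<Rightarrow> ('q, 'c) concrete_cat \<Rightarrow>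
   ('o \<Rightarrow> 'q \<Rightarrow> ('a \<Rightarrow> 'c) set) \<Rightarrow> ('q \<Rightarrow> 'o \<Rightarrow> ('c \<Rightarrow> 'a) set) \<Rightarrow>
   ('p, 'b, 'q, 'c) fctr \<Rightarrow> ('o, 'a, 'p, 'b) fctr \<Rightarrow> bool" where
  "contra_left_quasi_inverse C D C' H H' G F \<longleftrightarrow>
     is_contravariant_functor C D F \<and> is_contravariant_functor D C' G \<and>
     naturally_isomorphic C C C' H H' id_fctr (comp_contra G F)"

type_synonym 'a pspace = "'a topology \<times> 'a"

definition boolean_space :: "'a topology \<Rightarrow> bool" where
  "boolean_space X \<longleftrightarrow>
     compact_space X \<and> Hausdorff_space X \<and>
     neighbourhood_base_of (\<lambda>U. openin X U \<and> closedin X U) X"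

definition zdK_ob :: "'a pspace set" where
  "zdK_ob = {(X, p). boolean_space X \<and> p \<in> topspace X}"

definition zdK_hom :: "'a pspace \<Rightarrow> 'b pspace \<Rightarrow> ('a \<Rightarrow> 'b) set" where
  "zdK_hom X Y =
     {f \<in> topspace (fst X) \<rightarrow>\<^sub>E topspace (fst Y).
        continuous_map (fst X) (fst Y) f \<and> f (snd X) = snd Y}"

definition zdK :: "('a pspace, 'a) concrete_cat" where
  "zdK = \<lparr>Ob = zdK_ob, Pts = (\<lambda>X. topspace (fst X)), Hom = zdK_hom\<rparr>"

record 'a glat =
  carr :: "'a set"
  join :: "'a \<Rightarrow> 'a \<Rightarrow> 'a"
  meet :: "'a \<Rightarrow> 'a \<Rightarrow> 'a"
  bott :: 'a

record 'a balg = "'a glat" +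
  topp :: 'a
  neg :: "'a \<Rightarrow> 'a"

definition distrib_lattice_bot :: "('a, 'm) glat_scheme \<Rightarrow> bool" where
  "distrib_lattice_bot L \<longleftrightarrow>
     (\<forall>a\<in>carr L. \<forall>b\<in>carr L. join L a b \<in> carr L \<and> meet L a b \<in> carr L) \<and>
     (\<forall>a\<in>carr L. \<forall>b\<in>carr L. join L a b = join L b a \<and> meet L a b = meet L b a) \<and>
     (\<forall>a\<in>carr L. \<forall>b\<in>carr L. \<forall>c\<in>carr L.
        join L (join L a b) c = join L a (join L b c) \<and>
        meet L (meet L a b) c = meet L a (meet L b c)) \<and>
     (\<forall>a\<in>carr L. \<forall>b\<in>carr L. join L a (meet L a b) = a \<and> meet L a (join L a b) = a) \<and>
     (\<forall>a\<in>carr L. \<forall>b\<in>carr L. \<forall>c\<in>carr L.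
        meet L a (join L b c) = join L (meet L a b) (meet L a c)) \<and>
     bott L \<in> carr L \<and> (\<forall>a\<in>carr L. join L (bott L) a = a)"

definition gen_boolean_algebra :: "'a glat \<Rightarrow> bool" where
  "gen_boolean_algebra A \<longleftrightarrow>
     distrib_lattice_bot A \<and>
     (\<forall>a\<in>carr A. \<forall>b\<in>carr A. \<exists>c\<in>carr A. join A c b = join A a b \<and> meet A c b = bott A)"

definition boolean_alg :: "'a balg \<Rightarrow> bool" where
  "boolean_alg B \<longleftrightarrow>
     distrib_lattice_bot B \<and>
     topp B \<in> carr B \<and> (\<forall>a\<in>carr B. meet B (topp B) a = a) \<and>
     (\<forall>a\<in>carr B. neg B a \<in> carr B \<and> join B a (neg B a) = topp B \<and> meet B a (neg B a) = bott B)"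

text \<open>The order of a lattice is given by \<open>a \<le> b\<close> iff \<open>meet L a b = a\<close>.\<close>

definition lattice_ideal :: "('a, 'm) glat_scheme \<Rightarrow> 'a set \<Rightarrow> bool" where
  "lattice_ideal L I \<longleftrightarrow>
     I \<subseteq> carr L \<and> bott L \<in> I \<and>
     (\<forall>a\<in>I. \<forall>b\<in>I. join L a b \<in> I) \<and>
     (\<forall>a\<in>I. \<forall>b\<in>carr L. meet L a b = b \<longrightarrow> b \<in> I)"

definition maximal_ideal :: "'a balg \<Rightarrow> 'a set \<Rightarrow> bool" where
  "maximal_ideal B I \<longleftrightarrow>
     lattice_ideal B I \<and> I \<noteq> carr B \<and>
     (\<forall>J. lattice_ideal B J \<and> J \<noteq> carr B \<and> I \<subseteq> J \<longrightarrow> J = I)"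

definition lattice_filter :: "'a balg \<Rightarrow> 'a set \<Rightarrow> bool" where
  "lattice_filter B F \<longleftrightarrow>
     F \<subseteq> carr B \<and> topp B \<in> F \<and>
     (\<forall>a\<in>F. \<forall>b\<in>F. meet B a b \<in> F) \<and>
     (\<forall>a\<in>F. \<forall>b\<in>carr B. meet B a b = a \<longrightarrow> b \<in> F)"

definition ultrafilter_of :: "'a balg \<Rightarrow> 'a set \<Rightarrow> bool" where
  "ultrafilter_of B F \<longleftrightarrow>
     lattice_filter B F \<and> F \<noteq> carr B \<and>
     (\<forall>G. lattice_filter B G \<and> G \<noteq> carr B \<and> F \<subseteq> G \<longrightarrow> G = F)"

definition lattice_bot_hom ::
  "('a, 'm) glat_scheme \<Rightarrow> ('b, 'n) glat_scheme \<Rightarrow> ('a \<Rightarrow> 'b) set" where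
  "lattice_bot_hom L M =
     {f \<in> carr L \<rightarrow>\<^sub>E carr M.
        (\<forall>a\<in>carr L. \<forall>b\<in>carr L.
           f (join L a b) = join M (f a) (f b) \<and> f (meet L a b) = meet M (f a) (f b)) \<and>
        f (bott L) = bott M}"

definition boolean_hom :: "'a balg \<Rightarrow> 'b balg \<Rightarrow> ('a \<Rightarrow> 'b) set" where
  "boolean_hom B C =
     {f \<in> lattice_bot_hom B C.
        f (topp B) = topp C \<and> (\<forall>a\<in>carr B. f (neg B a) = neg C (f a))}"

definition gBa :: "('a glat, 'a) concrete_cat" where
  "gBa = \<lparr>Ob = {A. gen_boolean_algebra A}, Pts = carr, Hom = lattice_bot_hom\<rparr>"

type_synonym 'a ibalg = "'a balg \<times> 'a set"

definition iBa_ob :: "'a ibalg set" where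
  "iBa_ob = {(B, I). boolean_alg B \<and> maximal_ideal B I}"

definition iBa_hom :: "'a ibalg \<Rightarrow> 'b ibalg \<Rightarrow> ('a \<Rightarrow> 'b) set" where
  "iBa_hom X Y =
     {f \<in> boolean_hom (fst X) (fst Y). {a \<in> carr (fst X). f a \<in> snd Y} = snd X}"

definition iBa :: "('a ibalg, 'a) concrete_cat" where
  "iBa = \<lparr>Ob = iBa_ob, Pts = (\<lambda>X. carr (fst X)), Hom = iBa_hom\<rparr>"

definition clop :: "'a topology \<Rightarrow> 'a set balg" where
  "clop X =
     \<lparr>carr = {U. openin X U \<and> closedin X U}, join = (\<union>), meet = (\<inter>), bott = {},
      topp = topspace X, neg = (\<lambda>U. topspace X - U)\<rparr>"

definition IB :: "('a pspace, 'a, 'a set ibalg, 'a set) fctr" where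
  "IB =
     \<lparr>on_ob = (\<lambda>(X, p). (clop X, {b \<in> carr (clop X). p \<notin> b})),
      on_mor = (\<lambda>X Y f. \<lambda>b \<in> carr (clop (fst Y)). {x \<in> topspace (fst X). f x \<in> b})\<rparr>"

definition stone_space :: "'a balg \<Rightarrow> 'a set topology" where
  "stone_space B =
     topology_generated_by {{u. ultrafilter_of B u \<and> b \<in> u} | b. b \<in> carr B}"

definition S_star :: "('a ibalg, 'a, 'a set pspace, 'a set) fctr" where
  "S_star =
     \<lparr>on_ob = (\<lambda>(B, I). (stone_space B, carr B - I)),
      on_mor = (\<lambda>X Y f. \<lambda>u \<in> {u. ultrafilter_of (fst Y) u}. {b \<in> carr (fst X). f b \<in> u})\<rparr>"

definition F_fctr :: "('a ibalg, 'a, 'a glat, 'a) fctr" where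
  "F_fctr =
     \<lparr>on_ob = (\<lambda>(B, I). \<lparr>carr = I, join = join B, meet = meet B, bott = bott B\<rparr>),
      on_mor = (\<lambda>X Y f. restrict f (snd X))\<rparr>"

definition diff :: "'a glat \<Rightarrow> 'a \<Rightarrow> 'a \<Rightarrow> 'a" where
  "diff A a b = (THE c. c \<in> carr A \<and> join A c b = join A a b \<and> meet A c b = bott A)"

text \<open>The disjoint union of \<open>A\<close> and its copy: \<open>Inl a\<close> stands for \<open>a\<close> and \<open>Inr a\<close> for \<open>a'\<close>.\<close>

fun B_join :: "'a glat \<Rightarrow> 'a + 'a \<Rightarrow> 'a + 'a \<Rightarrow> 'a + 'a" where
  "B_join A (Inl a) (Inl b) = Inl (join A a b)"
| "B_join A (Inl a) (Inr b) = Inr (diff A b a)"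
| "B_join A (Inr a) (Inl b) = Inr (diff A a b)"
| "B_join A (Inr a) (Inr b) = Inr (meet A a b)"

fun B_meet :: "'a glat \<Rightarrow> 'a + 'a \<Rightarrow> 'a + 'a \<Rightarrow> 'a + 'a" where
  "B_meet A (Inl a) (Inl b) = Inl (meet A a b)"
| "B_meet A (Inl a) (Inr b) = Inl (diff A a b)"
| "B_meet A (Inr a) (Inl b) = Inl (diff A b a)"
| "B_meet A (Inr a) (Inr b) = Inr (join A a b)"

fun B_neg :: "'a + 'a \<Rightarrow> 'a + 'a" where
  "B_neg (Inl a) = Inr a"
| "B_neg (Inr a) = Inl a"

definition B_alg :: "'a glat \<Rightarrow> ('a + 'a) balg" where
  "B_alg A =
     \<lparr>carr = carr A <+> carr A, join = B_join A, meet = B_meet A, bott = Inl (bott A),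
      topp = Inr (bott A), neg = B_neg\<rparr>"

definition B_fctr :: "('a glat, 'a, ('a + 'a) ibalg, 'a + 'a) fctr" where
  "B_fctr =
     \<lparr>on_ob = (\<lambda>A. (B_alg A, Inl ` carr A)),
      on_mor = (\<lambda>X Y f. restrict (map_sum f f) (carr (B_alg X)))\<rparr>"

end

theory Submission
  imports Defs
begin

text \<open>
  Prime filters separate the points of a distributive lattice (Zorn), so every lattice identity can
  be checked by membership in a prime filter, where it becomes propositional. This makes \<open>B_alg A\<close>
  a Boolean algebra: an element \<open>a'\<close> lies in the filter extending \<open>P\<close> iff \<open>a \<notin> P\<close>. In a Boolean
  algebra the ultrafilters are the nonempty prime filters, and an ideal is maximal iff its complement
  is an ultrafilter. The unit \<open>(B, I) \<rightarrow> \<B>\<F>(B, I)\<close> sends \<open>b\<close> to itself if \<open>b \<in> I\<close> and to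
  \<open>(\<not> b)'\<close> otherwise. For Stone duality, \<open>x \<mapsto> {U. x \<in> U}\<close> is a continuous bijection from a
  compact space to a Hausdorff space, and compactness of the Stone space shows that every clopen set
  comes from an element of \<open>B\<close>; the distinguished points and ideals correspond by complementation.
\<close>

subsection \<open>Prime filters of distributive lattices\<close>

text \<open>Checked directly, each law of \<open>B_alg A\<close> would split over all choices of
  copies and end in identities between differences. The two-valued reading avoids this: for a prime
  filter \<open>P\<close> of \<open>A\<close>, sending \<open>a\<close> to the truth value of
  \<open>a \<in> P\<close> and \<open>a'\<close> to that of \<open>a \<notin> P\<close> respects all
  operations, and these maps are jointly injective. This is why the empty filter must count as
  prime: if \<open>A\<close> has a top, then \<open>a\<close> and the primed complement of
  \<open>a\<close> agree at every nonempty prime filter, and only the empty one tells them apart.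
  Conversely, the empty filter is the trace on a maximal ideal \<open>I\<close> of the ultrafilter
  complementary to \<open>I\<close>. All units are obtained as bijective morphisms, so injectivity
  comes down to separation. Inverses of bijective homomorphisms are again homomorphisms, whereas
  continuity of the inverse needs topology. As the functors change the type, each unit runs between
  two instances of one category, and every map is restricted to its carrier so that equations
  between morphisms hold in HOL.\<close>

text \<open>
  The empty set counts as prime, so prime filters are exactly the lattice homomorphisms to the
  two-element lattice that preserve \<open>\<bottom>\<close>; the empty one is the point at infinity.
\<close>

definition prime_filter :: "('a, 'm) glat_scheme \<Rightarrow> 'a set \<Rightarrow> bool" where
  "prime_filter L P \<longleftrightarrow> P \<subseteq> carr L \<and> bott L \<notin> P \<and>
     (\<forall>a\<in>carr L. \<forall>b\<in>carr L.
        (join L a b \<in> P \<longleftrightarrow> a \<in> P \<or> b \<in> P) \<and> (meet L a b \<in> P \<longleftrightarrow> a \<in> P \<and> b \<in> P))"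

text \<open>Unlike \<open>lattice_filter\<close>, this makes sense in a lattice without top. It
  admits the empty set and the whole carrier, so nonemptiness and avoidance of an element are stated
  where they matter.\<close>

definition up_filter :: "('a, 'm) glat_scheme \<Rightarrow> 'a set \<Rightarrow> bool" where
  "up_filter L F \<longleftrightarrow> F \<subseteq> carr L \<and> (\<forall>a\<in>F. \<forall>b\<in>F. meet L a b \<in> F) \<and>
     (\<forall>a\<in>F. \<forall>b\<in>carr L. meet L a b = a \<longrightarrow> b \<in> F)"

lemma prime_filter_join:
  "\<lbrakk>prime_filter L P; a \<in> carr L; b \<in> carr L\<rbrakk> \<Longrightarrow> join L a b \<in> P \<longleftrightarrow> a \<in> P \<or> b \<in> P"
  by (auto simp: prime_filter_def)

lemma prime_filter_meet:
  "\<lbrakk>prime_filter L P; a \<in> carr L; b \<in> carr L\<rbrakk> \<Longrightarrow> meet L a b \<in> P \<longleftrightarrow> a \<in> P \<and> b \<in> P"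
  by (auto simp: prime_filter_def)

lemma prime_filter_bott: "prime_filter L P \<Longrightarrow> bott L \<notin> P"
  by (auto simp: prime_filter_def)

lemma prime_filter_empty: "prime_filter L {}"
  by (auto simp: prime_filter_def)

lemmas prime_filter_iffs = prime_filter_join prime_filter_meet prime_filter_bott

locale dist_lattice =
  fixes L :: "('a, 'm) glat_scheme"
  assumes ax: "distrib_lattice_bot L"
begin

lemma
  shows join_closed [simp, intro]: "\<lbrakk>a \<in> carr L; b \<in> carr L\<rbrakk> \<Longrightarrow> join L a b \<in> carr L"
    and meet_closed [simp, intro]: "\<lbrakk>a \<in> carr L; b \<in> carr L\<rbrakk> \<Longrightarrow> meet L a b \<in> carr L"
    and bott_closed [simp, intro]: "bott L \<in> carr L"
  using ax by (simp_all add: distrib_lattice_bot_def)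

lemma
  shows join_comm: "\<lbrakk>a \<in> carr L; b \<in> carr L\<rbrakk> \<Longrightarrow> join L a b = join L b a"
    and meet_comm: "\<lbrakk>a \<in> carr L; b \<in> carr L\<rbrakk> \<Longrightarrow> meet L a b = meet L b a"
    and join_assoc: "\<lbrakk>a \<in> carr L; b \<in> carr L; c \<in> carr L\<rbrakk> \<Longrightarrow>
      join L (join L a b) c = join L a (join L b c)"
    and meet_assoc: "\<lbrakk>a \<in> carr L; b \<in> carr L; c \<in> carr L\<rbrakk> \<Longrightarrow>
      meet L (meet L a b) c = meet L a (meet L b c)"
    and join_absorb: "\<lbrakk>a \<in> carr L; b \<in> carr L\<rbrakk> \<Longrightarrow> join L a (meet L a b) = a"
    and meet_absorb: "\<lbrakk>a \<in> carr L; b \<in> carr L\<rbrakk> \<Longrightarrow> meet L a (join L a b) = a"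
    and meet_join_distrib: "\<lbrakk>a \<in> carr L; b \<in> carr L; c \<in> carr L\<rbrakk> \<Longrightarrow>
      meet L a (join L b c) = join L (meet L a b) (meet L a c)"
    and join_bott: "a \<in> carr L \<Longrightarrow> join L (bott L) a = a"
  using ax unfolding distrib_lattice_bot_def by blast+

lemma meet_idem: "a \<in> carr L \<Longrightarrow> meet L a a = a"
  by (metis join_absorb meet_absorb meet_closed)

lemma meet_bott: "a \<in> carr L \<Longrightarrow> meet L (bott L) a = bott L"
  by (metis bott_closed join_bott meet_absorb)

lemma meet_mono:
  assumes "a \<in> carr L" "b \<in> carr L" "c \<in> carr L" "meet L a b = a"
  shows "meet L (meet L a c) b = meet L a c"
  by (metis assms meet_assoc meet_comm)

lemma le_trans:
  assumes "a \<in> carr L" "b \<in> carr L" "c \<in> carr L" "meet L a b = a" "meet L b c = b"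
  shows "meet L a c = a"
  by (metis assms meet_assoc)

lemma le_join:
  assumes "a \<in> carr L" "b \<in> carr L"
  shows "meet L a (join L a b) = a" "meet L b (join L a b) = b"
  using assms by (simp add: meet_absorb, metis join_comm meet_absorb)

lemma le_meet:
  assumes "a \<in> carr L" "b \<in> carr L"
  shows "meet L (meet L a b) a = meet L a b" "meet L (meet L a b) b = meet L a b"
  by (metis assms meet_assoc meet_comm meet_idem, metis assms meet_assoc meet_idem)

text \<open>Meant for exploiting maximality: if a filter is maximal among those avoiding
  \<open>b\<close>, adjoining a missing \<open>x\<close> must produce some \<open>m\<close> in it
  with \<open>m \<and> x \<le> b\<close>.\<close>

lemma up_filter_adjoin:
  assumes F: "up_filter L F" and x: "x \<in> carr L"
  shows "up_filter L {z \<in> carr L. \<exists>m\<in>F. meet L (meet L m x) z = meet L m x}"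
    (is "up_filter L ?G")
proof -
  have sub: "F \<subseteq> carr L" and cl: "\<And>a b. a \<in> F \<Longrightarrow> b \<in> F \<Longrightarrow> meet L a b \<in> F"
    using F by (auto simp: up_filter_def)
  have "meet L a b \<in> ?G" if "a \<in> ?G" "b \<in> ?G" for a b
  proof -
    from that obtain m n where ab: "a \<in> carr L" "b \<in> carr L" and mn: "m \<in> F" "n \<in> F"
      and a: "meet L (meet L m x) a = meet L m x" and b: "meet L (meet L n x) b = meet L n x"
      by blast
    have mnc: "m \<in> carr L" "n \<in> carr L" using mn sub by auto
    \<comment> \<open>A common lower bound of the two witnesses \<open>meet L m x\<close> and
      \<open>meet L n x\<close>.\<close>
    let ?k = "meet L (meet L m n) x"
    have k: "?k \<in> carr L" using mnc x by auto
    have k1: "?k = meet L (meet L m x) n" "?k = meet L (meet L n x) m"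
      using mnc x by (metis meet_assoc meet_comm)+
    have "meet L ?k a = ?k" "meet L ?k b = ?k"
      using meet_mono[OF _ ab(1) mnc(2) a] meet_mono[OF _ ab(2) mnc(1) b] k1 mnc x by auto
    then have "meet L ?k (meet L a b) = ?k" using k ab by (metis meet_assoc)
    then show ?thesis using cl[OF mn] ab by blast
  qed
  moreover have "b \<in> ?G" if "a \<in> ?G" "b \<in> carr L" "meet L a b = a" for a b
  proof -
    from that obtain m where m: "m \<in> F" "meet L (meet L m x) a = meet L m x" and a: "a \<in> carr L"
      by blast
    then have "meet L (meet L m x) b = meet L m x"
      using le_trans[of "meet L m x" a b] that sub x by blast
    then show ?thesis using m that(2) by blast
  qed
  ultimately show ?thesis unfolding up_filter_def by blast
qed

text \<open>A filter maximal among those that contain \<open>F\<close> and avoid \<open>b\<close> is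
  prime: if neither \<open>x\<close> nor \<open>y\<close> lies in it, adjoining either one captures
  \<open>b\<close>, so \<open>m \<and> x \<le> b\<close> and \<open>n \<and> y \<le> b\<close>, and
  distributivity puts \<open>b\<close> above \<open>(m \<and> n) \<and> (x \<or> y)\<close>.\<close>

lemma prime_filter_extension:
  assumes F: "up_filter L F" "F \<noteq> {}" and b: "b \<in> carr L" "b \<notin> F"
  obtains P where "prime_filter L P" "F \<subseteq> P" "b \<notin> P"
proof -
  let ?A = "{G. up_filter L G \<and> F \<subseteq> G \<and> b \<notin> G}"
  have "\<exists>M\<in>?A. \<forall>X\<in>?A. M \<subseteq> X \<longrightarrow> X = M"
  proof (rule subset_Zorn_nonempty)
    show "?A \<noteq> {}" using F b by blast
    fix C assume "C \<noteq> {}" and ch: "subset.chain ?A C"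
    then have C: "C \<subseteq> ?A" and tot: "\<And>X Y. X \<in> C \<Longrightarrow> Y \<in> C \<Longrightarrow> X \<subseteq> Y \<or> Y \<subseteq> X"
      by (auto simp: subset_chain_def)
    have CD: "up_filter L X \<and> F \<subseteq> X \<and> b \<notin> X" if "X \<in> C" for X
      using C that by blast
    have "meet L x y \<in> \<Union>C" if "x \<in> \<Union>C" "y \<in> \<Union>C" for x y
    proof -
      from that obtain X Y where "X \<in> C" "Y \<in> C" "x \<in> X" "y \<in> Y" by blast
      with tot[of X Y] obtain Z where "Z \<in> C" "x \<in> Z" "y \<in> Z" by blast
      then have "meet L x y \<in> Z" using CD by (simp add: up_filter_def)
      then show ?thesis using \<open>Z \<in> C\<close> by blast
    qed
    moreover have "y \<in> \<Union>C" if xy: "x \<in> \<Union>C" "y \<in> carr L" "meet L x y = x" for x y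
    proof -
      from xy(1) obtain X where X: "X \<in> C" "x \<in> X" by blast
      then have "y \<in> X" using CD[OF X(1)] xy(2,3) by (simp add: up_filter_def)
      then show ?thesis using X(1) by blast
    qed
    moreover have "\<Union>C \<subseteq> carr L"
      using CD unfolding up_filter_def by blast
    ultimately have "up_filter L (\<Union>C)"
      unfolding up_filter_def by simp
    moreover have "b \<notin> \<Union>C" "F \<subseteq> \<Union>C" using CD \<open>C \<noteq> {}\<close> by auto
    ultimately show "\<Union>C \<in> ?A" by simp
  qed
  then obtain M where MA: "M \<in> ?A" and maxA: "\<forall>X\<in>?A. M \<subseteq> X \<longrightarrow> X = M" ..
  from MA have M: "up_filter L M" "F \<subseteq> M" "b \<notin> M" by auto
  from maxA have max: "\<And>X. \<lbrakk>up_filter L X; F \<subseteq> X; b \<notin> X; M \<subseteq> X\<rbrakk> \<Longrightarrow> X = M" by simp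
  have sub: "M \<subseteq> carr L"
    and cl: "\<And>x y. x \<in> M \<Longrightarrow> y \<in> M \<Longrightarrow> meet L x y \<in> M"
    and up: "\<And>x y. \<lbrakk>x \<in> M; y \<in> carr L; meet L x y = x\<rbrakk> \<Longrightarrow> y \<in> M"
    using M(1) unfolding up_filter_def by blast+
  have adj: "\<exists>m\<in>M. meet L (meet L m x) b = meet L m x" if x: "x \<in> carr L" "x \<notin> M" for x
  proof (rule ccontr)
    assume neg: "\<not> ?thesis"
    let ?G = "{z \<in> carr L. \<exists>m\<in>M. meet L (meet L m x) z = meet L m x}"
    have "z \<in> ?G" if "z \<in> M" for z using that sub x(1) le_meet(1) by blast
    then have "M \<subseteq> ?G" by blast
    moreover have "F \<subseteq> ?G" using M(2) \<open>M \<subseteq> ?G\<close> by (rule subset_trans)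
    moreover have "b \<notin> ?G" using neg by simp
    ultimately have "?G = M" using max[OF up_filter_adjoin[OF M(1) x(1)]] by simp
    \<comment> \<open>Membership of \<open>x\<close> is witnessed by
      \<open>m \<and> x \<le> x\<close>; adjoining \<open>x\<close> to an empty filter would give
      the empty set.\<close>
    moreover obtain m where "m \<in> M" using F(2) M(2) by blast
    then have "x \<in> ?G" using sub x(1) le_meet(2) by blast
    ultimately show False using x(2) by blast
  qed
  have "x \<in> M \<or> y \<in> M" if xy: "x \<in> carr L" "y \<in> carr L" "join L x y \<in> M" for x y
  proof (rule ccontr)
    assume "\<not> ?thesis"
    then have "x \<notin> M" "y \<notin> M" by blast+
    obtain m where m: "m \<in> M" "meet L (meet L m x) b = meet L m x"
      using adj[OF xy(1) \<open>x \<notin> M\<close>] by blast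
    obtain n where n: "n \<in> M" "meet L (meet L n y) b = meet L n y"
      using adj[OF xy(2) \<open>y \<notin> M\<close>] by blast
    note mn = m(1) n(1)
    have mnc: "m \<in> carr L" "n \<in> carr L" using mn sub by auto
    let ?k = "meet L m n"
    have k: "?k \<in> carr L" "?k \<in> M" using mnc cl mn by auto
    have "meet L ?k x = meet L (meet L m x) n" "meet L ?k y = meet L (meet L n y) m"
      using mnc xy by (metis meet_assoc meet_comm)+
    then have e: "meet L (meet L ?k x) b = meet L ?k x" "meet L (meet L ?k y) b = meet L ?k y"
      using meet_mono[OF _ b(1) mnc(2) m(2)] meet_mono[OF _ b(1) mnc(1) n(2)] mnc xy by auto
    have c: "meet L ?k x \<in> carr L" "meet L ?k y \<in> carr L" "meet L ?k (join L x y) \<in> carr L"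
      using k xy by auto
    \<comment> \<open>Distributivity splits \<open>?k \<and> (x \<or> y)\<close> into two parts,
      each below \<open>b\<close> by \<open>e\<close>.\<close>
    have "meet L (meet L ?k (join L x y)) b = meet L b (meet L ?k (join L x y))"
      by (rule meet_comm[OF c(3) b(1)])
    also have "\<dots> = meet L b (join L (meet L ?k x) (meet L ?k y))"
      by (simp only: meet_join_distrib[OF k(1) xy(1,2)])
    also have "\<dots> = join L (meet L (meet L ?k x) b) (meet L (meet L ?k y) b)"
      by (simp only: meet_join_distrib[OF b(1) c(1,2)] meet_comm[OF b(1) c(1)] meet_comm[OF b(1) c(2)])
    also have "\<dots> = meet L ?k (join L x y)"
      by (simp only: e meet_join_distrib[OF k(1) xy(1,2)])
    finally show False using up[OF cl[OF k(2) xy(3)] b(1)] M(3) by blast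
  qed
  then have "join L x y \<in> M \<longleftrightarrow> x \<in> M \<or> y \<in> M" if "x \<in> carr L" "y \<in> carr L" for x y
    using that up[of x "join L x y"] up[of y "join L x y"] by (auto simp: le_join)
  moreover have "meet L x y \<in> M \<longleftrightarrow> x \<in> M \<and> y \<in> M" if "x \<in> carr L" "y \<in> carr L" for x y
    using that up[of "meet L x y" x] up[of "meet L x y" y] cl[of x y] by (auto simp: le_meet)
  moreover have "bott L \<notin> M" using up[OF _ b(1)] M(3) meet_bott b(1) by blast
  ultimately have "prime_filter L M" using sub by (simp add: prime_filter_def)
  then show ?thesis using that M by blast
qed

text \<open>Prime filters separate points, so lattice identities reduce to propositional logic.\<close>

lemma prime_filter_eqI:
  assumes a: "a \<in> carr L" and b: "b \<in> carr L"
    and eq: "\<And>P. prime_filter L P \<Longrightarrow> a \<in> P \<longleftrightarrow> b \<in> P"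
  shows "a = b"
proof -
  have le: "meet L x y = x" if x: "x \<in> carr L" and y: "y \<in> carr L"
    and imp: "\<And>P. prime_filter L P \<Longrightarrow> x \<in> P \<Longrightarrow> y \<in> P" for x y
  proof (rule ccontr)
    \<comment> \<open>The principal filter of \<open>x\<close>. If \<open>x \<le> y\<close> fails,
      it avoids \<open>y\<close>, and a prime filter extending it contradicts
      \<open>imp\<close>.\<close>
    let ?F = "{z \<in> carr L. meet L x z = x}"
    assume "meet L x y \<noteq> x"
    moreover have "meet L x (meet L z w) = x" if "z \<in> ?F" "w \<in> ?F" for z w
      using that x by (simp flip: meet_assoc)
    then have "up_filter L ?F"
      unfolding up_filter_def using x by (auto intro: le_trans)
    moreover have "x \<in> ?F" using x by (simp add: meet_idem)
    ultimately obtain P where "prime_filter L P" "?F \<subseteq> P" "y \<notin> P"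
      using prime_filter_extension[of ?F y] y by blast
    with \<open>x \<in> ?F\<close> imp show False by blast
  qed
  have "a = meet L a b" using le[OF a b] eq by simp
  also have "\<dots> = meet L b a" by (rule meet_comm[OF a b])
  also have "\<dots> = b" using le[OF b a] eq by simp
  finally show ?thesis .
qed

end

subsection \<open>Ultrafilters and maximal ideals\<close>

locale bool_alg =
  fixes B :: "'a balg"
  assumes ba: "boolean_alg B"
begin

sublocale dist_lattice B
  using ba by unfold_locales (simp add: boolean_alg_def)

lemma
  shows topp_closed [simp, intro]: "topp B \<in> carr B"
    and neg_closed [simp, intro]: "a \<in> carr B \<Longrightarrow> neg B a \<in> carr B"
    and meet_topp: "a \<in> carr B \<Longrightarrow> meet B (topp B) a = a"
    and join_neg: "a \<in> carr B \<Longrightarrow> join B a (neg B a) = topp B"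
    and meet_neg: "a \<in> carr B \<Longrightarrow> meet B a (neg B a) = bott B"
  using ba by (auto simp: boolean_alg_def)

lemma prime_filter_topp:
  assumes "prime_filter B P" "a \<in> P"
  shows "topp B \<in> P"
  using assms meet_topp prime_filter_meet[of B P "topp B" a] by (auto simp: prime_filter_def)

lemma prime_filter_neg:
  assumes "prime_filter B P" "topp B \<in> P" "a \<in> carr B"
  shows "neg B a \<in> P \<longleftrightarrow> a \<notin> P"
  using assms prime_filter_iffs(1,2)[OF assms(1,3) neg_closed[OF assms(3)]]
  by (auto simp: join_neg meet_neg prime_filter_bott)

text \<open>A prime filter without the top is empty and distinguishes nothing, so those containing
  the top suffice.\<close>

lemma eqI:
  assumes "a \<in> carr B" "b \<in> carr B"
    and "\<And>P. prime_filter B P \<Longrightarrow> topp B \<in> P \<Longrightarrow> a \<in> P \<longleftrightarrow> b \<in> P"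
  shows "a = b"
  using assms prime_filter_topp by (meson prime_filter_eqI)

lemma neg_neg: "a \<in> carr B \<Longrightarrow> neg B (neg B a) = a"
  by (rule eqI) (auto simp: prime_filter_neg)

lemma neg_topp: "neg B (topp B) = bott B" and neg_bott: "neg B (bott B) = topp B"
  by (rule eqI; auto simp: prime_filter_neg prime_filter_bott)+

lemma neg_join: "\<lbrakk>a \<in> carr B; b \<in> carr B\<rbrakk> \<Longrightarrow> neg B (join B a b) = meet B (neg B a) (neg B b)"
  and neg_meet: "\<lbrakk>a \<in> carr B; b \<in> carr B\<rbrakk> \<Longrightarrow> neg B (meet B a b) = join B (neg B a) (neg B b)"
  by (rule eqI; auto simp: prime_filter_neg prime_filter_iffs)+

lemma prime_filter_lattice_filter:
  assumes P: "prime_filter B P" and "topp B \<in> P"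
  shows "lattice_filter B P"
proof -
  have sub: "P \<subseteq> carr B" using P by (simp add: prime_filter_def)
  show ?thesis
    unfolding lattice_filter_def
  proof (intro conjI ballI impI)
    fix a b assume "a \<in> P" "b \<in> carr B" "meet B a b = a"
    then show "b \<in> P" using prime_filter_meet[OF P, of a b] sub by auto
  qed (use assms sub prime_filter_meet[OF P] in auto)
qed

text \<open>An ultrafilter extends to a prime filter, which is again a proper filter, so maximality
  makes the two equal. Conversely, a filter strictly above a prime one contains some
  \<open>x\<close> outside it, hence both \<open>x\<close> and its complement, hence
  \<open>bott B\<close>.\<close>

lemma ultrafilter_iff: "ultrafilter_of B u \<longleftrightarrow> prime_filter B u \<and> topp B \<in> u"
proof
  assume u: "ultrafilter_of B u"
  then have filt: "up_filter B u" and t: "topp B \<in> u" and ne: "u \<noteq> carr B"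
    and max: "\<And>G. \<lbrakk>lattice_filter B G; G \<noteq> carr B; u \<subseteq> G\<rbrakk> \<Longrightarrow> G = u"
    by (auto simp: ultrafilter_of_def lattice_filter_def up_filter_def)
  have "bott B \<notin> u"
    using filt ne meet_bott by (auto simp: up_filter_def)
  then obtain P where P: "prime_filter B P" "u \<subseteq> P"
    using prime_filter_extension[OF filt, of "bott B"] t by blast
  have "lattice_filter B P"
    using P t prime_filter_lattice_filter by blast
  then have "P = u" using max P prime_filter_bott by fastforce
  then show "prime_filter B u \<and> topp B \<in> u" using P t by simp
next
  assume u: "prime_filter B u \<and> topp B \<in> u"
  then have "lattice_filter B u"
    using prime_filter_lattice_filter by blast
  moreover have "u \<noteq> carr B" using u prime_filter_bott by fastforce
  moreover have "G = u" if G: "lattice_filter B G" "G \<noteq> carr B" "u \<subseteq> G" for G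
  proof (rule ccontr)
    assume "G \<noteq> u"
    then obtain x where x: "x \<in> G" "x \<notin> u" "x \<in> carr B"
      using G by (auto simp: lattice_filter_def)
    then have "neg B x \<in> G" using u G prime_filter_neg by blast
    then have "bott B \<in> G" using x G meet_neg by (metis lattice_filter_def)
    then have "G = carr B" using G(1) meet_bott by (auto simp: lattice_filter_def)
    then show False using G(2) by blast
  qed
  ultimately show "ultrafilter_of B u" by (auto simp: ultrafilter_of_def)
qed

lemma lattice_ideal_Compl:
  assumes "ultrafilter_of B u"
  shows "lattice_ideal B (carr B - u)"
proof -
  have u: "prime_filter B u" using assms ultrafilter_iff by blast
  have "b \<notin> u" if "a \<in> carr B - u" "b \<in> carr B" "meet B a b = b" for a b
    using that prime_filter_meet[OF u, of a b] by auto
  then show ?thesis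
    unfolding lattice_ideal_def by (auto simp: prime_filter_iffs[OF u])
qed

text \<open>Prime extension is available for filters only, so a maximal ideal is first turned into
  the filter of elements whose complement lies in \<open>I\<close>. A prime filter above that one is
  disjoint from \<open>I\<close>, and what lies outside it is a proper ideal containing
  \<open>I\<close>, hence \<open>I\<close> itself.\<close>

lemma maximal_ideal_iff: "maximal_ideal B I \<longleftrightarrow> I \<subseteq> carr B \<and> ultrafilter_of B (carr B - I)"
proof
  assume I: "maximal_ideal B I"
  then have li: "lattice_ideal B I" and ne: "I \<noteq> carr B"
    by (simp_all add: maximal_ideal_def)
  then have sub: "I \<subseteq> carr B" and bI: "bott B \<in> I"
    and jo: "\<And>a b. a \<in> I \<Longrightarrow> b \<in> I \<Longrightarrow> join B a b \<in> I"
    and dn: "\<And>a b. \<lbrakk>a \<in> I; b \<in> carr B; meet B a b = b\<rbrakk> \<Longrightarrow> b \<in> I"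
    unfolding lattice_ideal_def by simp_all
  have max: "\<And>J. \<lbrakk>lattice_ideal B J; J \<noteq> carr B; I \<subseteq> J\<rbrakk> \<Longrightarrow> J = I"
    using I by (simp add: maximal_ideal_def)
  let ?F = "{a \<in> carr B. neg B a \<in> I}"
  have "neg B b \<in> I" if "a \<in> ?F" "b \<in> carr B" "meet B a b = a" for a b
  proof (rule dn)
    have "join B (neg B a) (neg B b) = neg B a"
      using that neg_meet[of a b] by simp
    then show "meet B (neg B a) (neg B b) = neg B b"
      using that by (metis (lifting) le_join(2) mem_Collect_eq meet_comm neg_closed)
  qed (use that in auto)
  then have F: "up_filter B ?F"
    unfolding up_filter_def using jo by (auto simp: neg_meet)
  have "topp B \<notin> I" using dn ne sub by (metis meet_topp subsetI subset_antisym)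
  then have "bott B \<notin> ?F" by (simp add: neg_bott)
  moreover have tF: "topp B \<in> ?F" using bI by (simp add: neg_topp)
  ultimately obtain P where P: "prime_filter B P" "?F \<subseteq> P"
    using prime_filter_extension[OF F, of "bott B"] by blast
  then have u: "ultrafilter_of B P" using tF by (auto simp: ultrafilter_iff)
  have tP: "topp B \<in> P" using u ultrafilter_iff by blast
  have "I \<subseteq> carr B - P"
  proof
    fix x assume x: "x \<in> I"
    then have "neg B x \<in> ?F" using sub by (simp add: neg_neg subset_iff)
    then have "neg B x \<in> P" using P(2) by blast
    then show "x \<in> carr B - P" using x sub prime_filter_neg[OF P(1) tP] by blast
  qed
  then have "carr B - P = I"
    using max[OF lattice_ideal_Compl[OF u]] tP by blast
  moreover have "P \<subseteq> carr B" using P(1) by (simp add: prime_filter_def)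
  ultimately have "carr B - I = P" by blast
  then show "I \<subseteq> carr B \<and> ultrafilter_of B (carr B - I)" using u sub by simp
next
  assume I: "I \<subseteq> carr B \<and> ultrafilter_of B (carr B - I)"
  let ?P = "carr B - I"
  have P: "prime_filter B ?P" "topp B \<in> ?P" using I ultrafilter_iff by blast+
  have eq: "carr B - ?P = I" using I by blast
  have "J = I" if J: "lattice_ideal B J" "J \<noteq> carr B" "I \<subseteq> J" for J
  proof (rule ccontr)
    assume "J \<noteq> I"
    then obtain x where x: "x \<in> J" "x \<in> ?P" using J by (auto simp: lattice_ideal_def)
    then have "neg B x \<in> I" using prime_filter_neg[OF P] by auto
    then have "topp B \<in> J" using x J join_neg by (metis DiffD1 lattice_ideal_def subsetD)
    then have "J = carr B" using J(1) meet_topp by (auto simp: lattice_ideal_def)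
    then show False using J(2) by blast
  qed
  moreover have "lattice_ideal B I"
    using lattice_ideal_Compl[of ?P] I unfolding eq by blast
  moreover have "I \<noteq> carr B" using P(2) by blast
  ultimately show "maximal_ideal B I"
    unfolding maximal_ideal_def by simp
qed

end

subsection \<open>Concrete categories\<close>

lemma id_mor_apply [simp]: "x \<in> A \<Longrightarrow> id_mor A x = x"
  by (simp add: id_mor_def)

lemma id_mor_funcset: "id_mor A \<in> A \<rightarrow>\<^sub>E A"
  by (simp add: id_mor_def)

lemma is_categoryI:
  assumes "\<And>X Y f. \<lbrakk>X \<in> Ob C; Y \<in> Ob C; f \<in> Hom C X Y\<rbrakk> \<Longrightarrow> f \<in> Pts C X \<rightarrow>\<^sub>E Pts C Y"
    "\<And>X. X \<in> Ob C \<Longrightarrow> id_mor (Pts C X) \<in> Hom C X X"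
    "\<And>X Y Z f g. \<lbrakk>X \<in> Ob C; Y \<in> Ob C; Z \<in> Ob C; f \<in> Hom C X Y; g \<in> Hom C Y Z\<rbrakk> \<Longrightarrow>
      compose (Pts C X) g f \<in> Hom C X Z"
  shows "is_category C"
  using assms unfolding is_category_def subset_iff by simp

lemma is_functorI:
  assumes "is_category C" "is_category D"
    "\<And>X. X \<in> Ob C \<Longrightarrow> on_ob F X \<in> Ob D"
    "\<And>X Y f. \<lbrakk>X \<in> Ob C; Y \<in> Ob C; f \<in> Hom C X Y\<rbrakk> \<Longrightarrow>
      on_mor F X Y f \<in> Hom D (on_ob F X) (on_ob F Y)"
    "\<And>X. X \<in> Ob C \<Longrightarrow> on_mor F X X (id_mor (Pts C X)) = id_mor (Pts D (on_ob F X))"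
    "\<And>X Y Z f g. \<lbrakk>X \<in> Ob C; Y \<in> Ob C; Z \<in> Ob C; f \<in> Hom C X Y; g \<in> Hom C Y Z\<rbrakk> \<Longrightarrow>
      on_mor F X Z (compose (Pts C X) g f) =
        compose (Pts D (on_ob F X)) (on_mor F Y Z g) (on_mor F X Y f)"
  shows "is_functor C D F"
  using assms unfolding is_functor_def by simp

lemma is_contravariant_functorI:
  assumes "is_category C" "is_category D"
    "\<And>X. X \<in> Ob C \<Longrightarrow> on_ob F X \<in> Ob D"
    "\<And>X Y f. \<lbrakk>X \<in> Ob C; Y \<in> Ob C; f \<in> Hom C X Y\<rbrakk> \<Longrightarrow>
      on_mor F X Y f \<in> Hom D (on_ob F Y) (on_ob F X)"
    "\<And>X. X \<in> Ob C \<Longrightarrow> on_mor F X X (id_mor (Pts C X)) = id_mor (Pts D (on_ob F X))"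
    "\<And>X Y Z f g. \<lbrakk>X \<in> Ob C; Y \<in> Ob C; Z \<in> Ob C; f \<in> Hom C X Y; g \<in> Hom C Y Z\<rbrakk> \<Longrightarrow>
      on_mor F X Z (compose (Pts C X) g f) =
        compose (Pts D (on_ob F Z)) (on_mor F X Y f) (on_mor F Y Z g)"
  shows "is_contravariant_functor C D F"
  using assms unfolding is_contravariant_functor_def by simp

lemma naturally_isomorphicI:
  assumes "\<And>X. X \<in> Ob C \<Longrightarrow> is_iso (Pts D (on_ob F X)) (Pts D' (on_ob G X))
      (H (on_ob F X) (on_ob G X)) (H' (on_ob G X) (on_ob F X)) (\<eta> X)"
    "\<And>X Y f. \<lbrakk>X \<in> Ob C; Y \<in> Ob C; f \<in> Hom C X Y\<rbrakk> \<Longrightarrow>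
      compose (Pts D (on_ob F X)) (\<eta> Y) (on_mor F X Y f) =
      compose (Pts D (on_ob F X)) (on_mor G X Y f) (\<eta> X)"
  shows "naturally_isomorphic C D D' H H' F G"
  using assms unfolding naturally_isomorphic_def by (intro exI[of _ \<eta>]) simp

lemma id_comp_fctr_sel [simp]:
  "on_ob id_fctr X = X" "on_mor id_fctr X Y f = f"
  "on_ob (comp_fctr G F) X = on_ob G (on_ob F X)"
  "on_mor (comp_fctr G F) X Y f = on_mor G (on_ob F X) (on_ob F Y) (on_mor F X Y f)"
  "on_ob (comp_contra G F) X = on_ob G (on_ob F X)"
  "on_mor (comp_contra G F) X Y f = on_mor G (on_ob F Y) (on_ob F X) (on_mor F X Y f)"
  by (simp_all add: id_fctr_def comp_fctr_def comp_contra_def)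

lemma category_sel [simp]:
  "Ob gBa = {A. gen_boolean_algebra A}" "Pts gBa = carr" "Hom gBa = lattice_bot_hom"
  "Ob iBa = iBa_ob" "Pts iBa = (\<lambda>X. carr (fst X))" "Hom iBa = iBa_hom"
  "Ob zdK = zdK_ob" "Pts zdK = (\<lambda>X. topspace (fst X))" "Hom zdK = zdK_hom"
  by (simp_all add: gBa_def iBa_def zdK_def)

text \<open>The content is in the last assumption: for algebraic structures it follows from
  bijectivity, for spaces it rests on compactness. \<open>inv_into\<close> is unconstrained outside
  \<open>B\<close>, hence the \<open>restrict\<close>.\<close>

lemma is_isoI:
  assumes "f \<in> H" "bij_betw f A B" "restrict (inv_into A f) B \<in> H'"
  shows "is_iso A B H H' f"
proof -
  have "compose A (restrict (inv_into A f) B) f = id_mor A"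
    using assms(2) unfolding compose_def id_mor_def
    by (auto intro!: restrict_ext simp: bij_betw_inv_into_left bij_betwE)
  moreover have "compose B f (restrict (inv_into A f) B) = id_mor B"
    using assms(2) unfolding compose_def id_mor_def
    by (auto intro!: restrict_ext simp: bij_betw_inv_into_right)
  ultimately show ?thesis using assms(1,3) unfolding is_iso_def by blast
qed

lemma lattice_bot_homD:
  assumes "f \<in> lattice_bot_hom L M"
  shows "f \<in> carr L \<rightarrow>\<^sub>E carr M" "a \<in> carr L \<Longrightarrow> f a \<in> carr M"
    "\<lbrakk>a \<in> carr L; b \<in> carr L\<rbrakk> \<Longrightarrow> f (join L a b) = join M (f a) (f b)"
    "\<lbrakk>a \<in> carr L; b \<in> carr L\<rbrakk> \<Longrightarrow> f (meet L a b) = meet M (f a) (f b)"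
    "f (bott L) = bott M"
  using assms by (auto simp: lattice_bot_hom_def)

lemma lattice_bot_homI:
  assumes "f \<in> carr L \<rightarrow>\<^sub>E carr M"
    "\<And>a b. \<lbrakk>a \<in> carr L; b \<in> carr L\<rbrakk> \<Longrightarrow> f (join L a b) = join M (f a) (f b)"
    "\<And>a b. \<lbrakk>a \<in> carr L; b \<in> carr L\<rbrakk> \<Longrightarrow> f (meet L a b) = meet M (f a) (f b)"
    "f (bott L) = bott M"
  shows "f \<in> lattice_bot_hom L M"
  using assms by (simp add: lattice_bot_hom_def)

context dist_lattice
begin

lemma id_mor_lattice_bot_hom: "id_mor (carr L) \<in> lattice_bot_hom L L"
  by (rule lattice_bot_homI) (simp_all add: id_mor_funcset)

lemma compose_lattice_bot_hom:
  assumes f: "f \<in> lattice_bot_hom L M" and g: "g \<in> lattice_bot_hom M N"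
  shows "compose (carr L) g f \<in> lattice_bot_hom L N"
proof (rule lattice_bot_homI)
  show "compose (carr L) g f \<in> carr L \<rightarrow>\<^sub>E carr N"
    using lattice_bot_homD(2)[OF f] lattice_bot_homD(2)[OF g] by (auto simp: compose_def)
qed (simp_all add: compose_eq lattice_bot_homD[OF f] lattice_bot_homD[OF g])

lemma inv_lattice_bot_hom:
  assumes f: "f \<in> lattice_bot_hom L M" and bij: "bij_betw f (carr L) (carr M)"
    and M: "dist_lattice M"
  shows "restrict (inv_into (carr L) f) (carr M) \<in> lattice_bot_hom M L"
proof -
  let ?g = "inv_into (carr L) f"
  interpret M: dist_lattice M by (rule M)
  have gc: "?g b \<in> carr L" if "b \<in> carr M" for b
    using bij that by (metis bij_betw_imp_surj_on inv_into_into)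
  have fg: "f (?g b) = b" if "b \<in> carr M" for b
    using bij that by (rule bij_betw_inv_into_right)
  have gf: "?g (f a) = a" if "a \<in> carr L" for a
    using bij that by (rule bij_betw_inv_into_left)
  show ?thesis
  proof (rule lattice_bot_homI)
    show "restrict ?g (carr M) \<in> carr M \<rightarrow>\<^sub>E carr L" using gc by auto
    show "restrict ?g (carr M) (bott M) = bott L"
      using gf[of "bott L"] lattice_bot_homD(5)[OF f] by simp
  next
    fix a b assume ab: "a \<in> carr M" "b \<in> carr M"
    \<comment> \<open>The operations are compared after applying \<open>f\<close>; \<open>gf\<close>
      then cancels \<open>f\<close>.\<close>
    have "f (join L (?g a) (?g b)) = join M a b" "f (meet L (?g a) (?g b)) = meet M a b"
      using ab by (simp_all add: lattice_bot_homD[OF f] gc fg)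
    then have "?g (join M a b) = join L (?g a) (?g b)" "?g (meet M a b) = meet L (?g a) (?g b)"
      using gf[of "join L (?g a) (?g b)"] gf[of "meet L (?g a) (?g b)"] gc ab by auto
    then show "restrict ?g (carr M) (join M a b)
        = join L (restrict ?g (carr M) a) (restrict ?g (carr M) b)"
      "restrict ?g (carr M) (meet M a b)
        = meet L (restrict ?g (carr M) a) (restrict ?g (carr M) b)"
      using ab by auto
  qed
qed

end

subsection \<open>Generalized Boolean algebras\<close>

locale gen_bool_alg =
  fixes A :: "'a glat"
  assumes gba: "gen_boolean_algebra A"
begin

sublocale dist_lattice A
  using gba by unfold_locales (simp add: gen_boolean_algebra_def)

text \<open>The axiom gives existence only. Uniqueness, which makes the \<open>THE\<close> in
  \<open>diff\<close> meaningful, holds because the values of \<open>join A c b\<close> and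
  \<open>meet A c b\<close> determine in which prime filters \<open>c\<close> lies.\<close>

lemma
  assumes a: "a \<in> carr A" and b: "b \<in> carr A"
  shows diff_closed [simp, intro]: "diff A a b \<in> carr A"
    and join_diff: "join A (diff A a b) b = join A a b"
    and meet_diff: "meet A (diff A a b) b = bott A"
    and diff_eqI: "\<lbrakk>c \<in> carr A; join A c b = join A a b; meet A c b = bott A\<rbrakk> \<Longrightarrow> diff A a b = c"
proof -
  let ?Q = "\<lambda>c. c \<in> carr A \<and> join A c b = join A a b \<and> meet A c b = bott A"
  have ex: "\<exists>c. ?Q c"
    using gba a b unfolding gen_boolean_algebra_def by blast
  have uniq: "c = d" if "?Q c" "?Q d" for c d
  proof (rule prime_filter_eqI)
    fix P assume P: "prime_filter A P"
    have "c \<in> P \<or> b \<in> P \<longleftrightarrow> d \<in> P \<or> b \<in> P"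
      using prime_filter_join[OF P, of c b] prime_filter_join[OF P, of d b] that b by simp
    moreover have "\<not> (c \<in> P \<and> b \<in> P)" "\<not> (d \<in> P \<and> b \<in> P)"
      using prime_filter_meet[OF P, of c b] prime_filter_meet[OF P, of d b] prime_filter_bott[OF P]
        that b by simp_all
    ultimately show "c \<in> P \<longleftrightarrow> d \<in> P" by blast
  qed (use that in auto)
  have ex1: "\<exists>!c. ?Q c" using ex uniq by blast
  have "?Q (diff A a b)" unfolding diff_def by (rule theI'[OF ex1])
  then show "diff A a b \<in> carr A" "join A (diff A a b) b = join A a b"
    "meet A (diff A a b) b = bott A" by simp_all
  assume "c \<in> carr A" "join A c b = join A a b" "meet A c b = bott A"
  then show "diff A a b = c"
    using uniq \<open>?Q (diff A a b)\<close> by blast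
qed

lemma prime_filter_diff:
  assumes P: "prime_filter A P" and ab: "a \<in> carr A" "b \<in> carr A"
  shows "diff A a b \<in> P \<longleftrightarrow> a \<in> P \<and> b \<notin> P"
proof -
  have "join A (diff A a b) b \<in> P \<longleftrightarrow> join A a b \<in> P" "meet A (diff A a b) b \<notin> P"
    using ab prime_filter_bott[OF P] by (simp_all add: join_diff meet_diff)
  then show ?thesis using ab by (auto simp: prime_filter_iffs[OF P])
qed

end

text \<open>Membership in the prime filter of \<open>B_alg A\<close> whose trace on \<open>A\<close> is \<open>P\<close>.\<close>

definition sum_mem :: "'a set \<Rightarrow> 'a + 'a \<Rightarrow> bool" where
  "sum_mem P x = (case x of Inl a \<Rightarrow> a \<in> P | Inr a \<Rightarrow> a \<notin> P)"

lemma sum_mem_simps [simp]: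
  "sum_mem P (Inl a) \<longleftrightarrow> a \<in> P" "sum_mem P (Inr a) \<longleftrightarrow> a \<notin> P"
  by (simp_all add: sum_mem_def)

lemma B_alg_sel [simp]:
  "carr (B_alg A) = carr A <+> carr A" "join (B_alg A) = B_join A" "meet (B_alg A) = B_meet A"
  "bott (B_alg A) = Inl (bott A)" "topp (B_alg A) = Inr (bott A)" "neg (B_alg A) = B_neg"
  by (simp_all add: B_alg_def)

context gen_bool_alg
begin

text \<open>\<open>sum_mem {}\<close> is false on every \<open>Inl a\<close> and true on every
  \<open>Inr a\<close>, which forces \<open>x\<close> and \<open>y\<close> into the same copy; there
  separation in \<open>A\<close> applies.\<close>

lemma sum_mem_eqI:
  assumes x: "x \<in> carr A <+> carr A" and y: "y \<in> carr A <+> carr A"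
    and eq: "\<And>P. prime_filter A P \<Longrightarrow> sum_mem P x \<longleftrightarrow> sum_mem P y"
  shows "x = y"
  using x y eq eq[OF prime_filter_empty] by (elim PlusE) (auto intro: prime_filter_eqI)

text \<open>The case tables of \<open>B_join\<close> and \<open>B_meet\<close> collapse to single
  connectives because a difference is read as "a and not b".\<close>

lemma sum_mem_ops:
  assumes P: "prime_filter A P" and "x \<in> carr A <+> carr A" "y \<in> carr A <+> carr A"
  shows "sum_mem P (B_join A x y) \<longleftrightarrow> sum_mem P x \<or> sum_mem P y"
    "sum_mem P (B_meet A x y) \<longleftrightarrow> sum_mem P x \<and> sum_mem P y"
    "sum_mem P (B_neg x) \<longleftrightarrow> \<not> sum_mem P x"
  using assms(2,3) by (auto simp: prime_filter_iffs[OF P] prime_filter_diff[OF P])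

lemma sum_ops_closed [simp, intro]:
  "\<lbrakk>x \<in> carr A <+> carr A; y \<in> carr A <+> carr A\<rbrakk> \<Longrightarrow> B_join A x y \<in> carr A <+> carr A"
  "\<lbrakk>x \<in> carr A <+> carr A; y \<in> carr A <+> carr A\<rbrakk> \<Longrightarrow> B_meet A x y \<in> carr A <+> carr A"
  "x \<in> carr A <+> carr A \<Longrightarrow> B_neg x \<in> carr A <+> carr A"
  by auto

lemma boolean_alg_B_alg: "boolean_alg (B_alg A)"
proof -
  have c: "Inl (bott A) \<in> carr A <+> carr A" "Inr (bott A) \<in> carr A <+> carr A" by auto
  have [simp]: "sum_mem P (Inl (bott A)) \<longleftrightarrow> False" "sum_mem P (Inr (bott A)) \<longleftrightarrow> True"
    if "prime_filter A P" for P
    using prime_filter_bott[OF that] by auto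
  \<comment> \<open>\<open>sum_mem P x\<close> has to stay an atom, so that the laws turn into
    tautologies; only the operations and the two constants are evaluated.\<close>
  note [simp del] = sum_mem_simps and [simp] = sum_mem_ops c
  show ?thesis
    unfolding boolean_alg_def distrib_lattice_bot_def B_alg_sel
    by (intro conjI ballI; (rule sum_mem_eqI)?) auto
qed

text \<open>The complement of this ideal is the second copy of \<open>A\<close>, the filter on which
  \<open>sum_mem {}\<close> holds.\<close>

lemma maximal_ideal_B_alg: "maximal_ideal (B_alg A) (Inl ` carr A)"
proof -
  interpret B: bool_alg "B_alg A" by unfold_locales (rule boolean_alg_B_alg)
  have "(carr A <+> carr A) - Inl ` carr A = Inr ` carr A" by auto
  moreover have "prime_filter (B_alg A) (Inr ` carr A)"
    by (auto simp: prime_filter_def)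
  ultimately show ?thesis
    by (auto simp: B.maximal_ideal_iff B.ultrafilter_iff)
qed

end

section \<open>Maximal ideals as generalized Boolean algebras\<close>

locale idealized_bool_alg = bool_alg B for B :: "'a balg" +
  fixes I :: "'a set"
  assumes max_ideal: "maximal_ideal B I"
begin

lemma ideal_subset: "I \<subseteq> carr B" and ultrafilter_Compl: "ultrafilter_of B (carr B - I)"
  using max_ideal by (simp_all add: maximal_ideal_iff)

lemma ideal_closed [simp]: "a \<in> I \<Longrightarrow> a \<in> carr B"
  using ideal_subset by blast

lemma
  shows join_ideal: "\<lbrakk>a \<in> carr B; b \<in> carr B\<rbrakk> \<Longrightarrow> join B a b \<in> I \<longleftrightarrow> a \<in> I \<and> b \<in> I"
    and meet_ideal: "\<lbrakk>a \<in> carr B; b \<in> carr B\<rbrakk> \<Longrightarrow> meet B a b \<in> I \<longleftrightarrow> a \<in> I \<or> b \<in> I"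
    and neg_ideal: "a \<in> carr B \<Longrightarrow> neg B a \<in> I \<longleftrightarrow> a \<notin> I"
    and bott_ideal: "bott B \<in> I" and topp_ideal: "topp B \<notin> I"
proof -
  have P: "prime_filter B (carr B - I)" "topp B \<in> carr B - I"
    using ultrafilter_Compl by (simp_all add: ultrafilter_iff)
  show "\<lbrakk>a \<in> carr B; b \<in> carr B\<rbrakk> \<Longrightarrow> join B a b \<in> I \<longleftrightarrow> a \<in> I \<and> b \<in> I"
    "\<lbrakk>a \<in> carr B; b \<in> carr B\<rbrakk> \<Longrightarrow> meet B a b \<in> I \<longleftrightarrow> a \<in> I \<or> b \<in> I"
    using prime_filter_iffs(1,2)[OF P(1), of a b] by auto
  show "a \<in> carr B \<Longrightarrow> neg B a \<in> I \<longleftrightarrow> a \<notin> I"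
    using prime_filter_neg[OF P, of a] by auto
  show "bott B \<in> I" "topp B \<notin> I" using prime_filter_bott[OF P(1)] P(2) by auto
qed

lemmas ideal_iffs = join_ideal meet_ideal neg_ideal bott_ideal topp_ideal

end

lemma iBa_obD: "(B, I) \<in> iBa_ob \<Longrightarrow> idealized_bool_alg B I"
  by unfold_locales (simp_all add: iBa_ob_def)

lemma gBa_obD: "gen_boolean_algebra A \<Longrightarrow> gen_bool_alg A"
  by unfold_locales

abbreviation ideal_glat :: "'a balg \<Rightarrow> 'a set \<Rightarrow> 'a glat" where
  "ideal_glat B I \<equiv> \<lparr>carr = I, join = join B, meet = meet B, bott = bott B\<rparr>"

context idealized_bool_alg
begin

lemma gen_boolean_algebra_ideal: "gen_boolean_algebra (ideal_glat B I)"
proof -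
  have "distrib_lattice_bot (ideal_glat B I)"
    unfolding distrib_lattice_bot_def
    by (auto simp: ideal_iffs join_absorb meet_absorb join_assoc meet_assoc meet_join_distrib
        join_bott intro: join_comm meet_comm)
  \<comment> \<open>The difference is formed in \<open>B\<close> as
    \<open>a \<and> \<not> b\<close>; it stays in \<open>I\<close> because it lies below
    \<open>a\<close>.\<close>
  moreover have "\<exists>c\<in>I. join B c b = join B a b \<and> meet B c b = bott B" if "a \<in> I" "b \<in> I" for a b
    using that
    by (intro bexI[of _ "meet B a (neg B b)"] conjI eqI)
      (auto simp: ideal_iffs prime_filter_iffs prime_filter_neg)
  ultimately show ?thesis by (simp add: gen_boolean_algebra_def)
qed

text \<open>Translates the differences in the tables of \<open>B_alg\<close> over an ideal back into
  operations of \<open>B\<close>, as needed for the unit in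
  \<open>left_quasi_inverse_B_F\<close>.\<close>

lemma diff_ideal:
  assumes "a \<in> I" "b \<in> I"
  shows "diff (ideal_glat B I) a b = meet B a (neg B b)"
proof -
  interpret G: gen_bool_alg "ideal_glat B I"
    by unfold_locales (rule gen_boolean_algebra_ideal)
  have "join B (meet B a (neg B b)) b = join B a b" "meet B (meet B a (neg B b)) b = bott B"
    using assms by (auto intro!: eqI simp: prime_filter_iffs prime_filter_neg)
  then show ?thesis
    using assms by (intro G.diff_eqI) (auto simp: ideal_iffs)
qed

end

section \<open>The categories gBa and iBa and the functors between them\<close>

lemma is_category_gBa: "is_category (gBa :: ('a glat, 'a) concrete_cat)"
proof -
  have "id_mor (carr A) \<in> lattice_bot_hom A A" if "gen_boolean_algebra A" for A :: "'a glat"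
  proof -
    interpret gen_bool_alg A using that by (rule gBa_obD)
    show ?thesis by (rule id_mor_lattice_bot_hom)
  qed
  moreover have "compose (carr A) g f \<in> lattice_bot_hom A C"
    if "gen_boolean_algebra A" "f \<in> lattice_bot_hom A B" "g \<in> lattice_bot_hom B C"
    for A B C :: "'a glat" and f g
  proof -
    interpret gen_bool_alg A using that(1) by (rule gBa_obD)
    show ?thesis using that(2,3) by (rule compose_lattice_bot_hom)
  qed
  ultimately show ?thesis
    by (intro is_categoryI) (auto simp: lattice_bot_homD(1))
qed

lemma boolean_homD:
  assumes "f \<in> boolean_hom B C"
  shows "f \<in> lattice_bot_hom B C" "f (topp B) = topp C"
    "a \<in> carr B \<Longrightarrow> f (neg B a) = neg C (f a)"
  using assms by (auto simp: boolean_hom_def)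

lemma iBa_homD:
  assumes "f \<in> iBa_hom (B, I) (C, J)"
  shows "f \<in> boolean_hom B C" "f \<in> lattice_bot_hom B C" "a \<in> carr B \<Longrightarrow> f a \<in> J \<longleftrightarrow> a \<in> I"
    "a \<in> carr B \<Longrightarrow> f a \<in> carr C"
proof -
  show bh: "f \<in> boolean_hom B C" and "f \<in> lattice_bot_hom B C"
    using assms by (auto simp: iBa_hom_def boolean_hom_def)
  then show "a \<in> carr B \<Longrightarrow> f a \<in> carr C" by (simp add: lattice_bot_homD(2))
  have "{a \<in> carr B. f a \<in> J} = I" using assms by (simp add: iBa_hom_def)
  then show "a \<in> carr B \<Longrightarrow> f a \<in> J \<longleftrightarrow> a \<in> I" by blast
qed

lemma iBa_homI:
  assumes "f \<in> lattice_bot_hom B C" "f (topp B) = topp C"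
    "\<And>a. a \<in> carr B \<Longrightarrow> f (neg B a) = neg C (f a)"
    "\<And>a. a \<in> carr B \<Longrightarrow> f a \<in> J \<longleftrightarrow> a \<in> I" "I \<subseteq> carr B"
  shows "f \<in> iBa_hom (B, I) (C, J)"
  using assms by (auto simp: iBa_hom_def boolean_hom_def)

lemma is_category_iBa: "is_category (iBa :: ('a ibalg, 'a) concrete_cat)"
proof -
  have "id_mor (carr B) \<in> iBa_hom (B, I) (B, I)" if "(B, I) \<in> iBa_ob" for B :: "'a balg" and I
  proof -
    interpret idealized_bool_alg B I using that by (rule iBa_obD)
    show ?thesis by (rule iBa_homI) (auto simp: id_mor_lattice_bot_hom)
  qed
  moreover have "compose (carr B) g f \<in> iBa_hom (B, I) (D, K)"
    if "(B, I) \<in> iBa_ob" and f: "f \<in> iBa_hom (B, I) (C, J)" and g: "g \<in> iBa_hom (C, J) (D, K)"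
    for B C D :: "'a balg" and I J K f g
  proof -
    interpret idealized_bool_alg B I using that(1) by (rule iBa_obD)
    show ?thesis
      using compose_lattice_bot_hom[OF iBa_homD(2)[OF f] iBa_homD(2)[OF g]]
      by (intro iBa_homI) (auto simp: compose_eq iBa_homD[OF f] iBa_homD[OF g]
          boolean_homD[OF iBa_homD(1)[OF f]] boolean_homD[OF iBa_homD(1)[OF g]])
  qed
  moreover have "f \<in> carr B \<rightarrow>\<^sub>E carr C" if "f \<in> iBa_hom (B, I) (C, J)"
    for B C :: "'a balg" and I J f
    using lattice_bot_homD(1)[OF iBa_homD(2)[OF that]] .
  ultimately show ?thesis
    by (intro is_categoryI) (simp_all add: split_paired_all)
qed

text \<open>The ideal condition on morphisms is an equivalence, \<open>f a \<in> J\<close> iff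
  \<open>a \<in> I\<close>, and so passes to the inverse along with the operations. Both units that
  live in iBa are obtained this way.\<close>

lemma is_iso_iBa:
  assumes B: "(B, I) \<in> iBa_ob" and C: "(C, J) \<in> iBa_ob" and f: "f \<in> iBa_hom (B, I) (C, J)"
    and bij: "bij_betw f (carr B) (carr C)"
  shows "is_iso (carr B) (carr C) (iBa_hom (B, I) (C, J)) (iBa_hom (C, J) (B, I)) f"
proof -
  interpret B: idealized_bool_alg B I using B by (rule iBa_obD)
  interpret C: idealized_bool_alg C J using C by (rule iBa_obD)
  let ?g = "inv_into (carr B) f"
  have gc: "?g b \<in> carr B" if "b \<in> carr C" for b
    using bij that by (metis bij_betw_imp_surj_on inv_into_into)
  have fg: "f (?g b) = b" if "b \<in> carr C" for b
    using bij that by (rule bij_betw_inv_into_right)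
  have gf: "?g (f a) = a" if "a \<in> carr B" for a
    using bij that by (rule bij_betw_inv_into_left)
  note bh = boolean_homD[OF iBa_homD(1)[OF f]]
  have "restrict ?g (carr C) \<in> iBa_hom (C, J) (B, I)"
  proof (rule iBa_homI)
    show "restrict ?g (carr C) \<in> lattice_bot_hom C B"
      by (rule B.inv_lattice_bot_hom[OF bh(1) bij]) unfold_locales
    show "restrict ?g (carr C) (topp C) = topp B"
      using gf[of "topp B"] bh(2) by simp
    fix a assume a: "a \<in> carr C"
    then show "restrict ?g (carr C) a \<in> I \<longleftrightarrow> a \<in> J"
      using iBa_homD(3)[OF f gc[OF a]] fg[OF a] by simp
    have "f (neg B (?g a)) = neg C a" using bh(3)[OF gc[OF a]] fg[OF a] by simp
    then show "restrict ?g (carr C) (neg C a) = neg B (restrict ?g (carr C) a)"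
      using gf[of "neg B (?g a)"] gc[OF a] a by simp
  qed (rule C.ideal_subset)
  with f bij show ?thesis by (rule is_isoI)
qed

lemma F_fctr_sel [simp]:
  "on_ob F_fctr (B, I) = ideal_glat B I" "on_mor F_fctr (B, I) Y f = restrict f I"
  by (simp_all add: F_fctr_def)

lemma B_fctr_sel [simp]:
  "on_ob B_fctr A = (B_alg A, Inl ` carr A)"
  "on_mor B_fctr A Y f = restrict (map_sum f f) (carr A <+> carr A)"
  by (simp_all add: B_fctr_def)

lemma is_functor_F: "is_functor (iBa :: ('a ibalg, 'a) concrete_cat) gBa F_fctr"
proof -
  have "restrict f I \<in> lattice_bot_hom (ideal_glat B I) (ideal_glat C J)"
    if "(B, I) \<in> iBa_ob" and f: "f \<in> iBa_hom (B, I) (C, J)" for B C :: "'a balg" and I J f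
  proof -
    interpret idealized_bool_alg B I using that(1) by (rule iBa_obD)
    show ?thesis
      by (rule lattice_bot_homI)
        (auto simp: ideal_iffs iBa_homD[OF f] lattice_bot_homD[OF iBa_homD(2)[OF f]])
  qed
  moreover have "gen_boolean_algebra (ideal_glat B I)" if "(B, I) \<in> iBa_ob" for B :: "'a balg" and I
  proof -
    interpret idealized_bool_alg B I using that by (rule iBa_obD)
    show ?thesis by (rule gen_boolean_algebra_ideal)
  qed
  moreover have "restrict (id_mor (carr B)) I = id_mor I" if "(B, I) \<in> iBa_ob" for B :: "'a balg" and I
  proof -
    interpret idealized_bool_alg B I using that by (rule iBa_obD)
    show ?thesis using ideal_subset by (auto simp: id_mor_def restrict_def fun_eq_iff)
  qed
  moreover have "restrict (compose (carr B) g f) I = compose I (restrict g J) (restrict f I)"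
    if "(B, I) \<in> iBa_ob" and f: "f \<in> iBa_hom (B, I) (C, J)" for B C :: "'a balg" and I J f g
  proof -
    interpret idealized_bool_alg B I using that(1) by (rule iBa_obD)
    show ?thesis by (auto simp: compose_def restrict_def fun_eq_iff iBa_homD[OF f])
  qed
  ultimately show ?thesis
    by (intro is_functorI is_category_iBa is_category_gBa) (simp_all add: split_paired_all)
qed

lemma map_sum_iBa_hom:
  fixes A :: "'a glat" and A' :: "'b glat"
  assumes A: "gen_boolean_algebra A" and A': "gen_boolean_algebra A'"
    and f: "f \<in> lattice_bot_hom A A'"
  shows "restrict (map_sum f f) (carr A <+> carr A)
    \<in> iBa_hom (B_alg A, Inl ` carr A) (B_alg A', Inl ` carr A')"
proof -
  interpret A: gen_bool_alg A using A by (rule gBa_obD)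
  interpret A': gen_bool_alg A' using A' by (rule gBa_obD)
  note fD = lattice_bot_homD[OF f]
  \<comment> \<open>Differences are unique solutions of equations in join, meet and bottom, so a
    homomorphism for these preserves them too.\<close>
  have fdiff: "f (diff A a b) = diff A' (f a) (f b)" if "a \<in> carr A" "b \<in> carr A" for a b
    using that A.join_diff[of a b] A.meet_diff[of a b]
    by (intro A'.diff_eqI[symmetric]) (auto simp: fD simp flip: fD(3,4))
  show ?thesis
    by (intro iBa_homI lattice_bot_homI) (auto simp: fD fdiff)
qed

lemma is_functor_B: "is_functor gBa (iBa :: (('a + 'a) ibalg, 'a + 'a) concrete_cat) B_fctr"
proof -
  have "(B_alg A, Inl ` carr A) \<in> iBa_ob" if "gen_boolean_algebra A" for A :: "'a glat"
  proof -
    interpret gen_bool_alg A using that by (rule gBa_obD)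
    show ?thesis using boolean_alg_B_alg maximal_ideal_B_alg by (simp add: iBa_ob_def)
  qed
  moreover have "restrict (map_sum (id_mor S) (id_mor S)) (S <+> S) = id_mor (S <+> S)"
    for S :: "'a set"
    by (auto simp: id_mor_def restrict_def fun_eq_iff)
  moreover have "restrict (map_sum (compose (carr A) g f) (compose (carr A) g f)) (carr A <+> carr A) =
      compose (carr A <+> carr A) (restrict (map_sum g g) (carr A' <+> carr A'))
        (restrict (map_sum f f) (carr A <+> carr A))"
    if "f \<in> lattice_bot_hom A A'" for A A' :: "'a glat" and f g
    using lattice_bot_homD(2)[OF that]
    by (auto simp: compose_def restrict_def fun_eq_iff)
  ultimately show ?thesis
    by (intro is_functorI is_category_iBa is_category_gBa)
      (simp_all add: map_sum_iBa_hom)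
qed

section \<open>The equivalence of iBa and gBa\<close>

lemma left_quasi_inverse_B_F:
  "left_quasi_inverse (iBa :: ('c ibalg, 'c) concrete_cat) gBa
     (iBa :: (('c + 'c) ibalg, 'c + 'c) concrete_cat) iBa_hom iBa_hom B_fctr F_fctr"
proof -
  define \<eta> :: "'c ibalg \<Rightarrow> 'c \<Rightarrow> 'c + 'c" where
    "\<eta> X = (\<lambda>b\<in>carr (fst X). if b \<in> snd X then Inl b else Inr (neg (fst X) b))" for X
  have "is_iso (carr B) (I <+> I)
      (iBa_hom (B, I) (B_alg (ideal_glat B I), Inl ` I))
      (iBa_hom (B_alg (ideal_glat B I), Inl ` I) (B, I)) (\<eta> (B, I))"
    if ob: "(B, I) \<in> iBa_ob" for B I
  proof -
    interpret idealized_bool_alg B I using ob by (rule iBa_obD)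
    interpret G: gen_bool_alg "ideal_glat B I"
      by unfold_locales (rule gen_boolean_algebra_ideal)
    let ?B' = "B_alg (ideal_glat B I)"
    have hom: "\<eta> (B, I) \<in> iBa_hom (B, I) (?B', Inl ` I)"
    proof (intro iBa_homI lattice_bot_homI)
      \<comment> \<open>Each choice of which of \<open>a\<close>, \<open>b\<close> lie in
        \<open>I\<close> selects one row of the tables; with \<open>diff_ideal\<close> the rows
        reduce to De Morgan and double negation.\<close>
      fix a b assume ab: "a \<in> carr B" "b \<in> carr B"
      show "\<eta> (B, I) (join B a b) = join ?B' (\<eta> (B, I) a) (\<eta> (B, I) b)"
        "\<eta> (B, I) (meet B a b) = meet ?B' (\<eta> (B, I) a) (\<eta> (B, I) b)"
        using ab by (auto simp: \<eta>_def ideal_iffs diff_ideal neg_join neg_meet neg_neg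
            intro: meet_comm join_comm)
    qed (auto simp: \<eta>_def ideal_iffs neg_neg neg_topp)
    have "bij_betw (\<eta> (B, I)) (carr B) (I <+> I)"
    \<comment> \<open>The inverse reads \<open>a'\<close> as the complement of \<open>a\<close> and
      so folds the two copies back into \<open>B\<close>.\<close>
    proof (rule bij_betw_byWitness[where f' = "case_sum id (neg B)"])
    qed (auto simp: \<eta>_def ideal_iffs neg_neg)
    moreover have "(?B', Inl ` I) \<in> iBa_ob"
      using G.boolean_alg_B_alg G.maximal_ideal_B_alg by (simp add: iBa_ob_def)
    ultimately show ?thesis
      using is_iso_iBa[OF ob _ hom] by simp
  qed
  moreover have "compose (carr B) (\<eta> (C, J)) f =
      compose (carr B) (restrict (map_sum (restrict f I) (restrict f I)) (I <+> I)) (\<eta> (B, I))"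
    if ob: "(B, I) \<in> iBa_ob" and f: "f \<in> iBa_hom (B, I) (C, J)" for B I C J f
  proof -
    interpret idealized_bool_alg B I using ob by (rule iBa_obD)
    \<comment> \<open>A morphism preserves both the case distinction in \<open>\<eta>\<close> and
      the complement taken in the second case.\<close>
    show ?thesis
      by (auto simp: \<eta>_def compose_def fun_eq_iff restrict_def ideal_iffs iBa_homD[OF f]
          boolean_homD[OF iBa_homD(1)[OF f]])
  qed
  ultimately have "naturally_isomorphic (iBa :: ('c ibalg, 'c) concrete_cat) iBa iBa iBa_hom iBa_hom id_fctr (comp_fctr B_fctr F_fctr)"
    by (intro naturally_isomorphicI[where \<eta> = \<eta>]) (simp_all add: split_paired_all)
  then show ?thesis
    using is_functor_F is_functor_B unfolding left_quasi_inverse_def by blast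
qed

text \<open>The distinguished ideal of \<open>B_alg A\<close> is the first copy of \<open>A\<close>,
  where the operations are those of \<open>A\<close>; so \<open>Inl\<close> itself serves as the
  unit.\<close>

lemma left_quasi_inverse_F_B:
  "left_quasi_inverse gBa (iBa :: (('d + 'd) ibalg, 'd + 'd) concrete_cat)
     gBa lattice_bot_hom lattice_bot_hom F_fctr B_fctr"
proof -
  define \<eta> :: "'d glat \<Rightarrow> 'd \<Rightarrow> 'd + 'd" where "\<eta> A = restrict Inl (carr A)" for A
  have "is_iso (carr A) (Inl ` carr A)
      (lattice_bot_hom A (ideal_glat (B_alg A) (Inl ` carr A)))
      (lattice_bot_hom (ideal_glat (B_alg A) (Inl ` carr A)) A) (\<eta> A)"
    if ob: "gen_boolean_algebra A" for A
  proof -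
    interpret gen_bool_alg A using ob by (rule gBa_obD)
    interpret B: idealized_bool_alg "B_alg A" "Inl ` carr A"
      by unfold_locales (rule boolean_alg_B_alg, rule maximal_ideal_B_alg)
    interpret G: gen_bool_alg "ideal_glat (B_alg A) (Inl ` carr A)"
      by unfold_locales (rule B.gen_boolean_algebra_ideal)
    have hom: "\<eta> A \<in> lattice_bot_hom A (ideal_glat (B_alg A) (Inl ` carr A))"
      by (rule lattice_bot_homI) (auto simp: \<eta>_def)
    have bij: "bij_betw (\<eta> A) (carr A) (Inl ` carr A)"
      by (auto simp: \<eta>_def bij_betw_def inj_on_def)
    have "restrict (inv_into (carr A) (\<eta> A)) (Inl ` carr A)
        \<in> lattice_bot_hom (ideal_glat (B_alg A) (Inl ` carr A)) A"
      using inv_lattice_bot_hom[OF hom] bij G.dist_lattice_axioms by simp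
    with hom bij show ?thesis by (rule is_isoI)
  qed
  moreover have "compose (carr A) (\<eta> A') f = compose (carr A)
      (restrict (restrict (map_sum f f) (carr A <+> carr A)) (Inl ` carr A)) (\<eta> A)"
    if f: "f \<in> lattice_bot_hom A A'" for A A' :: "'d glat" and f
    by (auto simp: \<eta>_def compose_def fun_eq_iff restrict_def lattice_bot_homD[OF f])
  ultimately have "naturally_isomorphic gBa gBa gBa lattice_bot_hom lattice_bot_hom
      id_fctr (comp_fctr F_fctr (B_fctr :: ('d glat, _, _, _) fctr))"
    by (intro naturally_isomorphicI[where \<eta> = \<eta>]) simp_all
  then show ?thesis
    using is_functor_F is_functor_B unfolding left_quasi_inverse_def by blast
qed

subsection \<open>Stone duality\<close>

lemma clop_sel [simp]:
  "carr (clop X) = {U. openin X U \<and> closedin X U}" "join (clop X) = (\<union>)" "meet (clop X) = (\<inter>)"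
  "bott (clop X) = {}" "topp (clop X) = topspace X" "neg (clop X) = (\<lambda>U. topspace X - U)"
  by (simp_all add: clop_def)

lemma boolean_alg_clop: "boolean_alg (clop X)"
  unfolding boolean_alg_def distrib_lattice_bot_def clop_sel
  by (auto dest: openin_subset)

definition clop_at :: "'a topology \<Rightarrow> 'a \<Rightarrow> 'a set set" where
  "clop_at X p = {U. openin X U \<and> closedin X U \<and> p \<in> U}"

lemma ultrafilter_clop_at:
  assumes "p \<in> topspace X"
  shows "ultrafilter_of (clop X) (clop_at X p)"
proof -
  interpret bool_alg "clop X" by unfold_locales (rule boolean_alg_clop)
  show ?thesis
    using assms by (auto simp: ultrafilter_iff prime_filter_def clop_at_def)
qed

lemma IB_sel [simp]:
  "on_ob IB (X, p) = (clop X, {b \<in> carr (clop X). p \<notin> b})"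
  "on_mor IB (X, p) (Y, q) f = (\<lambda>b \<in> carr (clop Y). {x \<in> topspace X. f x \<in> b})"
  by (simp_all add: IB_def)

lemma S_star_sel [simp]:
  "on_ob S_star (B, I) = (stone_space B, carr B - I)"
  "on_mor S_star (B, I) (C, J) f = (\<lambda>u \<in> {u. ultrafilter_of C u}. {b \<in> carr B. f b \<in> u})"
  by (simp_all add: S_star_def)

text \<open>Removing the clopen sets that miss \<open>p\<close> leaves the ultrafilter
  \<open>clop_at X p\<close>, so maximality is an instance of
  \<open>maximal_ideal_iff\<close>.\<close>

lemma IB_ob:
  assumes "p \<in> topspace X"
  shows "(clop X, {b \<in> carr (clop X). p \<notin> b}) \<in> iBa_ob"
proof -
  interpret bool_alg "clop X" by unfold_locales (rule boolean_alg_clop)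
  have "carr (clop X) - {b \<in> carr (clop X). p \<notin> b} = clop_at X p"
    by (auto simp: clop_at_def)
  then show ?thesis
    using ultrafilter_clop_at[OF assms] boolean_alg_clop
    by (auto simp: iBa_ob_def maximal_ideal_iff)
qed

lemma zdK_homD:
  assumes "f \<in> zdK_hom (X, p) (Y, q)"
  shows "f \<in> topspace X \<rightarrow>\<^sub>E topspace Y" "continuous_map X Y f" "f p = q"
    "x \<in> topspace X \<Longrightarrow> f x \<in> topspace Y"
  using assms by (auto simp: zdK_hom_def)

lemma is_category_zdK: "is_category (zdK :: ('a pspace, 'a) concrete_cat)"
proof (rule is_categoryI)
  fix X :: "'a pspace" assume "X \<in> Ob zdK"
  moreover have "continuous_map Y Y (id_mor (topspace Y))" for Y :: "'a topology"
    by (rule continuous_map_eq[of _ _ id]) auto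
  ultimately show "id_mor (Pts zdK X) \<in> Hom zdK X X"
    by (auto simp: zdK_hom_def zdK_ob_def id_mor_funcset)
next
  fix X Y Z :: "'a pspace" and f g
  assume X: "X \<in> Ob zdK" and f: "f \<in> Hom zdK X Y" and g: "g \<in> Hom zdK Y Z"
  obtain X' p Y' q Z' r where XYZ: "X = (X', p)" "Y = (Y', q)" "Z = (Z', r)"
    by (metis surj_pair)
  note fD = zdK_homD[of f X' p Y' q] and gD = zdK_homD[of g Y' q Z' r]
  have "continuous_map X' Z' (compose (topspace X') g f)"
    using f g XYZ
    by (intro continuous_map_eq[OF continuous_map_compose[OF fD(2) gD(2)]]) (auto simp: compose_eq)
  then show "compose (Pts zdK X) g f \<in> Hom zdK X Z"
    using X f g XYZ by (auto simp: zdK_hom_def zdK_ob_def compose_def)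
qed (auto simp: zdK_hom_def)

lemma IB_hom:
  assumes p: "p \<in> topspace X" and f: "f \<in> zdK_hom (X, p) (Y, q)"
  shows "(\<lambda>b \<in> carr (clop Y). {x \<in> topspace X. f x \<in> b})
    \<in> iBa_hom (clop Y, {b \<in> carr (clop Y). q \<notin> b}) (clop X, {b \<in> carr (clop X). p \<notin> b})"
proof -
  have "openin X {x \<in> topspace X. f x \<in> b}" "closedin X {x \<in> topspace X. f x \<in> b}"
    if "openin Y b" "closedin Y b" for b
    using that zdK_homD(2)[OF f]
    by (auto intro: openin_continuous_map_preimage closedin_continuous_map_preimage)
  then show ?thesis
    by (intro iBa_homI lattice_bot_homI) (auto simp: p zdK_homD(3,4)[OF f])
qed

lemma is_contravariant_functor_IB:
  "is_contravariant_functor (zdK :: ('a pspace, 'a) concrete_cat) iBa IB"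
proof -
  have "(\<lambda>b\<in>S. {x \<in> topspace X. id_mor (topspace X) x \<in> b}) = id_mor S"
    if "S = carr (clop X)" for X :: "'a topology" and S
  proof -
    have "{x \<in> topspace X. id_mor (topspace X) x \<in> b} = b" if "openin X b" for b
      using openin_subset[OF that] by auto
    then show ?thesis using that by (auto simp: id_mor_def restrict_def fun_eq_iff)
  qed
  moreover have "(\<lambda>b\<in>U. {x \<in> topspace X. compose (topspace X) g f x \<in> b}) =
      compose U (\<lambda>b\<in>T. {x \<in> topspace X. f x \<in> b}) (\<lambda>b\<in>U. {x \<in> topspace Y. g x \<in> b})"
    if "T = carr (clop Y)" "U = carr (clop Z)" "f \<in> zdK_hom (X, p) (Y, q)" "g \<in> zdK_hom (Y, q) (Z, r)"
    for X Y Z :: "'a topology" and p q r f g T U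
  proof -
    \<comment> \<open>The outer map of the composite is restricted to clopen sets of
      \<open>Y\<close>, so the preimages under \<open>g\<close> must be shown to lie in its
      domain.\<close>
    have "openin Y {x \<in> topspace Y. g x \<in> b}" "closedin Y {x \<in> topspace Y. g x \<in> b}"
      if "b \<in> carr (clop Z)" for b
      using that zdK_homD(2)[OF \<open>g \<in> zdK_hom _ _\<close>]
      by (auto intro: openin_continuous_map_preimage closedin_continuous_map_preimage)
    then show ?thesis
      unfolding compose_def using that(1,2) zdK_homD(4)[OF that(3)]
      by (intro restrict_ext) auto
  qed
  ultimately show ?thesis
    by (intro is_contravariant_functorI is_category_zdK is_category_iBa)
      (simp_all add: split_paired_all zdK_ob_def IB_ob IB_hom del: clop_sel)
qed

section \<open>The Stone space of a Boolean algebra\<close>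

definition stone_open :: "'a balg \<Rightarrow> 'a \<Rightarrow> 'a set set" where
  "stone_open B b = {u. ultrafilter_of B u \<and> b \<in> u}"

context bool_alg
begin

lemma ultrafilter_bott: "ultrafilter_of B u \<Longrightarrow> bott B \<notin> u"
  and ultrafilter_topp: "ultrafilter_of B u \<Longrightarrow> topp B \<in> u"
  and ultrafilter_join:
    "\<lbrakk>ultrafilter_of B u; a \<in> carr B; b \<in> carr B\<rbrakk> \<Longrightarrow> join B a b \<in> u \<longleftrightarrow> a \<in> u \<or> b \<in> u"
  and ultrafilter_meet:
    "\<lbrakk>ultrafilter_of B u; a \<in> carr B; b \<in> carr B\<rbrakk> \<Longrightarrow> meet B a b \<in> u \<longleftrightarrow> a \<in> u \<and> b \<in> u"
  and ultrafilter_neg: "\<lbrakk>ultrafilter_of B u; a \<in> carr B\<rbrakk> \<Longrightarrow> neg B a \<in> u \<longleftrightarrow> a \<notin> u"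
  and ultrafilter_subset: "ultrafilter_of B u \<Longrightarrow> u \<subseteq> carr B"
  by (simp_all add: ultrafilter_iff prime_filter_iffs prime_filter_neg)
    (simp add: prime_filter_def)

lemmas ultrafilter_iffs =
  ultrafilter_bott ultrafilter_topp ultrafilter_join ultrafilter_meet ultrafilter_neg

lemma stone_open_ops:
  "stone_open B (bott B) = {}" "stone_open B (topp B) = {u. ultrafilter_of B u}"
  "\<lbrakk>a \<in> carr B; b \<in> carr B\<rbrakk> \<Longrightarrow> stone_open B (join B a b) = stone_open B a \<union> stone_open B b"
  "\<lbrakk>a \<in> carr B; b \<in> carr B\<rbrakk> \<Longrightarrow> stone_open B (meet B a b) = stone_open B a \<inter> stone_open B b"
  "a \<in> carr B \<Longrightarrow> stone_open B (neg B a) = {u. ultrafilter_of B u} - stone_open B a"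
  by (auto simp: stone_open_def ultrafilter_iffs)

text \<open>Separation by ultrafilters in another guise; it becomes injectivity of the unit.\<close>

lemma stone_open_inj: "inj_on (stone_open B) (carr B)"
proof (rule inj_onI, rule eqI)
  fix a b P assume "stone_open B a = stone_open B b" and P: "prime_filter B P" "topp B \<in> P"
  then have "P \<in> stone_open B a \<longleftrightarrow> P \<in> stone_open B b" by simp
  then show "a \<in> P \<longleftrightarrow> b \<in> P" using P by (simp add: stone_open_def ultrafilter_iff)
qed

lemma topspace_stone_space: "topspace (stone_space B) = {u. ultrafilter_of B u}"
proof -
  have "\<Union>{{u. ultrafilter_of B u \<and> b \<in> u} | b. b \<in> carr B} = {u. ultrafilter_of B u}"
    using ultrafilter_topp topp_closed by blast
  then show ?thesis by (simp add: stone_space_def)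
qed

lemma openin_stone_open: "b \<in> carr B \<Longrightarrow> openin (stone_space B) (stone_open B b)"
  unfolding stone_space_def stone_open_def by (rule topology_generated_by_Basis) blast

lemma closedin_stone_open:
  assumes "b \<in> carr B"
  shows "closedin (stone_space B) (stone_open B b)"
proof -
  have "topspace (stone_space B) - stone_open B b = stone_open B (neg B b)"
    using assms by (simp add: topspace_stone_space stone_open_ops)
  then show ?thesis
    using assms openin_stone_open[of "neg B b"]
    by (auto simp: closedin_def topspace_stone_space stone_open_def)
qed

text \<open>\<open>topology_generated_by\<close> takes the sets \<open>stone_open B b\<close> as a
  subbase only. They are already a base because \<open>meet\<close> makes them closed under binary
  intersection.\<close>

lemma stone_space_base:
  assumes "openin (stone_space B) W" "u \<in> W"
  obtains b where "b \<in> carr B" "u \<in> stone_open B b" "stone_open B b \<subseteq> W"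
proof -
  have "generate_topology_on {{u. ultrafilter_of B u \<and> b \<in> u} | b. b \<in> carr B} W"
    using assms(1) unfolding stone_space_def by (rule openin_topology_generated_by)
  then have "\<forall>u\<in>W. \<exists>b\<in>carr B. u \<in> stone_open B b \<and> stone_open B b \<subseteq> W"
  proof induction
    case (Int V W)
    show ?case
    proof
      fix u assume "u \<in> V \<inter> W"
      then obtain a b where "a \<in> carr B" "u \<in> stone_open B a" "stone_open B a \<subseteq> V"
        "b \<in> carr B" "u \<in> stone_open B b" "stone_open B b \<subseteq> W"
        using Int.IH by blast
      then show "\<exists>b\<in>carr B. u \<in> stone_open B b \<and> stone_open B b \<subseteq> V \<inter> W"
        by (intro bexI[of _ "meet B a b"]) (auto simp: stone_open_ops)
    qed
  next
    case (Basis s)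
    then show ?case unfolding stone_open_def by blast
  next
    case (UN K)
    then show ?case by (meson Union_iff Union_upper order_trans)
  qed auto
  then show ?thesis using assms(2) that by blast
qed

text \<open>Without a finite subcover, the elements whose basic set is finitely covered form a
  proper ideal, and the dual filter extends to an ultrafilter \<open>P\<close>. But some member of
  the cover contains a basic neighbourhood of \<open>P\<close>, whose index \<open>b\<close> thus
  lies in the ideal, so \<open>P\<close> contains both \<open>b\<close> and its complement.\<close>

lemma compact_stone_space: "compact_space (stone_space B)"
  unfolding compact_space_alt
proof (intro allI impI)
  fix \<U> assume "(\<forall>U\<in>\<U>. openin (stone_space B) U) \<and> topspace (stone_space B) \<subseteq> \<Union>\<U>"
  then have op: "\<And>U. U \<in> \<U> \<Longrightarrow> openin (stone_space B) U"
    and cov: "topspace (stone_space B) \<subseteq> \<Union>\<U>" by auto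
  \<comment> \<open>Since \<open>stone_open B (topp B)\<close> is the whole space, a finite subcover
    exists once \<open>topp B\<close> is in \<open>J\<close>.\<close>
  define J where "J = {c \<in> carr B. \<exists>\<F>. finite \<F> \<and> \<F> \<subseteq> \<U> \<and> stone_open B c \<subseteq> \<Union>\<F>}"
  let ?F = "{c \<in> carr B. neg B c \<in> J}"
  have J_join: "join B a b \<in> J" if "a \<in> J" "b \<in> J" for a b
  proof -
    from that obtain \<F> \<G> where ab: "a \<in> carr B" "b \<in> carr B"
      and "finite \<F>" "\<F> \<subseteq> \<U>" "stone_open B a \<subseteq> \<Union>\<F>" "finite \<G>" "\<G> \<subseteq> \<U>" "stone_open B b \<subseteq> \<Union>\<G>"
      unfolding J_def by blast
    then have "finite (\<F> \<union> \<G>) \<and> \<F> \<union> \<G> \<subseteq> \<U> \<and> stone_open B (join B a b) \<subseteq> \<Union>(\<F> \<union> \<G>)"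
      by (auto simp: stone_open_ops)
    then show ?thesis using ab unfolding J_def by blast
  qed
  have J_down: "b \<in> J" if "a \<in> J" "b \<in> carr B" "stone_open B b \<subseteq> stone_open B a" for a b
    using that unfolding J_def by blast
  have "topp B \<in> J"
  proof (rule ccontr)
    assume nt: "topp B \<notin> J"
    have "meet B a b \<in> ?F" if "a \<in> ?F" "b \<in> ?F" for a b
      using that J_join[of "neg B a" "neg B b"] by (simp add: neg_meet)
    moreover have "b \<in> ?F" if "a \<in> ?F" "b \<in> carr B" "meet B a b = a" for a b
    proof -
      have "stone_open B a \<subseteq> stone_open B b"
        using stone_open_ops(4)[of a b] that by auto
      then have "neg B b \<in> J"
        using that J_down[of "neg B a" "neg B b"] by (auto simp: stone_open_ops)
      then show ?thesis using that(2) by simp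
    qed
    ultimately have "up_filter B ?F" unfolding up_filter_def by simp
    moreover have "bott B \<in> J" unfolding J_def by (auto simp: stone_open_ops)
    then have "topp B \<in> ?F" by (simp add: neg_topp)
    moreover have "bott B \<notin> ?F" using nt by (simp add: neg_bott)
    ultimately obtain P where P: "prime_filter B P" "?F \<subseteq> P"
      using prime_filter_extension[of ?F "bott B"] by blast
    then have u: "ultrafilter_of B P" using \<open>topp B \<in> ?F\<close> by (auto simp: ultrafilter_iff)
    then obtain W where W: "W \<in> \<U>" "P \<in> W" using cov by (auto simp: topspace_stone_space)
    then obtain b where b: "b \<in> carr B" "P \<in> stone_open B b" "stone_open B b \<subseteq> W"
      using stone_space_base[OF op] by metis
    have "finite {W} \<and> {W} \<subseteq> \<U> \<and> stone_open B b \<subseteq> \<Union>{W}" using W b by simp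
    then have "b \<in> J" using b(1) unfolding J_def by blast
    then have "neg B b \<in> P" using b(1) P(2) by (auto simp: neg_neg)
    then show False using b(1,2) ultrafilter_neg[OF u] by (simp add: stone_open_def)
  qed
  then show "\<exists>\<F>. finite \<F> \<and> \<F> \<subseteq> \<U> \<and> topspace (stone_space B) \<subseteq> \<Union>\<F>"
    unfolding J_def by (simp add: stone_open_ops topspace_stone_space)
qed

lemma Hausdorff_stone_space: "Hausdorff_space (stone_space B)"
  unfolding Hausdorff_space_def
proof (intro allI impI)
  \<comment> \<open>Maximality makes distinct ultrafilters incomparable; the separating element and
    its complement then index the disjoint neighbourhoods.\<close>
  have sep: "\<exists>b\<in>carr B. b \<in> u \<and> b \<notin> v" if "ultrafilter_of B u" "ultrafilter_of B v" "u \<noteq> v" for u v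
  proof (rule ccontr)
    assume "\<not> ?thesis"
    then have "u \<subseteq> v" using ultrafilter_subset[OF that(1)] by blast
    then show False using that unfolding ultrafilter_of_def by blast
  qed
  fix u v
  assume "u \<in> topspace (stone_space B) \<and> v \<in> topspace (stone_space B) \<and> u \<noteq> v"
  then have uv: "ultrafilter_of B u" "ultrafilter_of B v" "u \<noteq> v"
    by (simp_all add: topspace_stone_space)
  then obtain b where b: "b \<in> carr B" "b \<in> u" "b \<notin> v" using sep by blast
  then have "u \<in> stone_open B b" "v \<in> stone_open B (neg B b)"
    "disjnt (stone_open B b) (stone_open B (neg B b))"
    using uv(1,2) by (auto simp: disjnt_def stone_open_def ultrafilter_neg)
  then show "\<exists>U V. openin (stone_space B) U \<and> openin (stone_space B) V \<and> u \<in> U \<and> v \<in> V \<and> disjnt U V"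
    using openin_stone_open[OF b(1)] openin_stone_open[OF neg_closed[OF b(1)]] by metis
qed

lemma boolean_space_stone_space: "boolean_space (stone_space B)"
proof -
  have "\<exists>U V. openin (stone_space B) U \<and> (openin (stone_space B) V \<and> closedin (stone_space B) V) \<and>
      u \<in> U \<and> U \<subseteq> V \<and> V \<subseteq> W" if "openin (stone_space B) W" "u \<in> W" for W u
    using stone_space_base[OF that] openin_stone_open closedin_stone_open by (metis order_refl)
  then show ?thesis
    unfolding boolean_space_def neighbourhood_base_of
    using compact_stone_space Hausdorff_stone_space by blast
qed

text \<open>A clopen set is compact, hence a finite union of basic sets, and \<open>join\<close>
  turns such a union into a single basic set. This becomes surjectivity of the unit.\<close>

lemma carr_clop_stone_space: "carr (clop (stone_space B)) = stone_open B ` carr B"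
proof
  show "stone_open B ` carr B \<subseteq> carr (clop (stone_space B))"
    using openin_stone_open closedin_stone_open by auto
  show "carr (clop (stone_space B)) \<subseteq> stone_open B ` carr B"
  proof
    fix W assume "W \<in> carr (clop (stone_space B))"
    then have W: "openin (stone_space B) W" "closedin (stone_space B) W" by auto
    \<comment> \<open>Only basic sets inside \<open>W\<close> are used, so that a finite subcover
      has union exactly \<open>W\<close>.\<close>
    let ?U = "{stone_open B b | b. b \<in> carr B \<and> stone_open B b \<subseteq> W}"
    have "compactin (stone_space B) W"
      by (rule closedin_compact_space[OF compact_stone_space W(2)])
    moreover have "W \<subseteq> \<Union>?U"
    proof
      fix u assume "u \<in> W"
      then obtain b where "b \<in> carr B" "u \<in> stone_open B b" "stone_open B b \<subseteq> W"
        using stone_space_base[OF W(1)] by metis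
      then show "u \<in> \<Union>?U" by auto
    qed
    moreover have "openin (stone_space B) U" if "U \<in> ?U" for U
      using that openin_stone_open by blast
    ultimately obtain \<F> where \<F>: "finite \<F>" "\<F> \<subseteq> ?U" "W \<subseteq> \<Union>\<F>"
      using compactinD[of "stone_space B" W ?U] by blast
    have "\<Union>\<F> \<in> stone_open B ` carr B" if "finite \<F>" "\<F> \<subseteq> stone_open B ` carr B" for \<F>
      using that
    proof induction
      case empty
      show ?case using stone_open_ops(1) by auto
    next
      case (insert U \<F>)
      then obtain a b where ab: "a \<in> carr B" "b \<in> carr B" "U = stone_open B a" "\<Union>\<F> = stone_open B b"
        by auto
      then have "\<Union>(insert U \<F>) = stone_open B (join B a b)" by (simp add: stone_open_ops)
      then show ?case using ab(1,2) by blast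
    qed
    from this[OF \<F>(1)] have "\<Union>\<F> \<in> stone_open B ` carr B" using \<F>(2) by blast
    moreover have "\<Union>\<F> = W" using \<F>(2,3) by blast
    ultimately show "W \<in> stone_open B ` carr B" by simp
  qed
qed

end

text \<open>By \<open>ultrafilter_iff\<close> this is composition with a homomorphism to the
  two-element algebra, a form that pulls back more readily than maximality.\<close>

lemma ultrafilter_preimage:
  assumes B: "boolean_alg B" and C: "boolean_alg C" and f: "f \<in> boolean_hom B C"
    and u: "ultrafilter_of C u"
  shows "ultrafilter_of B {b \<in> carr B. f b \<in> u}"
proof -
  interpret B: bool_alg B using B by unfold_locales
  interpret C: bool_alg C using C by unfold_locales
  note fD = boolean_homD(2)[OF f] lattice_bot_homD(2-5)[OF boolean_homD(1)[OF f]]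
  show ?thesis
    unfolding B.ultrafilter_iff prime_filter_def using u by (auto simp: fD C.ultrafilter_iffs)
qed

lemma S_star_ob:
  assumes "(B, I) \<in> iBa_ob"
  shows "(stone_space B, carr B - I) \<in> zdK_ob"
proof -
  interpret idealized_bool_alg B I using assms by (rule iBa_obD)
  show ?thesis
    using boolean_space_stone_space ultrafilter_Compl by (simp add: zdK_ob_def topspace_stone_space)
qed

lemma S_star_hom:
  assumes B: "(B, I) \<in> iBa_ob" and C: "(C, J) \<in> iBa_ob" and f: "f \<in> iBa_hom (B, I) (C, J)"
  shows "(\<lambda>u \<in> {u. ultrafilter_of C u}. {b \<in> carr B. f b \<in> u})
    \<in> zdK_hom (stone_space C, carr C - J) (stone_space B, carr B - I)" (is "?g \<in> _")
proof -
  interpret B: idealized_bool_alg B I using B by (rule iBa_obD)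
  interpret C: idealized_bool_alg C J using C by (rule iBa_obD)
  have uf: "ultrafilter_of B {b \<in> carr B. f b \<in> u}" if "ultrafilter_of C u" for u
    using ultrafilter_preimage[OF B.ba C.ba iBa_homD(1)[OF f] that] .
  have "continuous_map (stone_space C) (stone_space B) ?g"
    unfolding stone_space_def[of B]
  proof (rule continuous_on_generated_topo)
    show "?g ` topspace (stone_space C) \<subseteq> \<Union>{{u. ultrafilter_of B u \<and> b \<in> u} | b. b \<in> carr B}"
      using uf B.ultrafilter_topp by (auto simp: C.topspace_stone_space)
    fix U assume "U \<in> {{u. ultrafilter_of B u \<and> b \<in> u} | b. b \<in> carr B}"
    then obtain b where b: "b \<in> carr B" "U = {u. ultrafilter_of B u \<and> b \<in> u}" by blast
    then have "?g -` U \<inter> topspace (stone_space C) = stone_open C (f b)"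
      using uf by (auto simp: C.topspace_stone_space stone_open_def)
    then show "openin (stone_space C) (?g -` U \<inter> topspace (stone_space C))"
      using C.openin_stone_open iBa_homD(4)[OF f b(1)] by simp
  qed
  \<comment> \<open>\<open>carr C - J\<close> is in the domain of \<open>?g\<close> as
    \<open>J\<close> is maximal; since \<open>f\<close> both preserves and reflects the ideals, it
    pulls back to exactly \<open>carr B - I\<close>.\<close>
  moreover have "?g (carr C - J) = carr B - I"
  proof -
    have "?g (carr C - J) = {b \<in> carr B. f b \<in> carr C - J}"
      by (rule restrict_apply') (simp add: C.ultrafilter_Compl)
    also have "\<dots> = carr B - I" using iBa_homD(3,4)[OF f] by blast
    finally show ?thesis .
  qed
  moreover have "?g \<in> topspace (stone_space C) \<rightarrow>\<^sub>E topspace (stone_space B)"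
    unfolding C.topspace_stone_space B.topspace_stone_space by (simp add: uf)
  ultimately show ?thesis by (simp add: zdK_hom_def)
qed

lemma is_contravariant_functor_S_star:
  "is_contravariant_functor (iBa :: ('a ibalg, 'a) concrete_cat) zdK S_star"
proof -
  have "(\<lambda>u\<in>{u. ultrafilter_of B u}. {b \<in> carr B. id_mor (carr B) b \<in> u})
      = id_mor (topspace (stone_space B))"
    if "(B, I) \<in> iBa_ob" for B :: "'a balg" and I
  proof -
    interpret idealized_bool_alg B I using that by (rule iBa_obD)
    have "{b \<in> carr B. id_mor (carr B) b \<in> u} = u" if "ultrafilter_of B u" for u
      using ultrafilter_subset[OF that] by auto
    then show ?thesis
      unfolding topspace_stone_space id_mor_def[of "{u. ultrafilter_of B u}"]
      by (intro restrict_ext) simp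
  qed
  moreover have "(\<lambda>u\<in>{u. ultrafilter_of D u}. {b \<in> carr B. compose (carr B) g f b \<in> u}) =
      compose (topspace (stone_space D)) (\<lambda>u\<in>{u. ultrafilter_of C u}. {b \<in> carr B. f b \<in> u})
        (\<lambda>u\<in>{u. ultrafilter_of D u}. {b \<in> carr C. g b \<in> u})"
    if "(B, I) \<in> iBa_ob" "(C, J) \<in> iBa_ob" "(D, K) \<in> iBa_ob"
      and f: "f \<in> iBa_hom (B, I) (C, J)" and g: "g \<in> iBa_hom (C, J) (D, K)"
    for B C D :: "'a balg" and I J K f g
  proof -
    interpret B: idealized_bool_alg B I using that(1) by (rule iBa_obD)
    interpret C: idealized_bool_alg C J using that(2) by (rule iBa_obD)
    interpret D: idealized_bool_alg D K using that(3) by (rule iBa_obD)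
    show ?thesis
      unfolding compose_def D.topspace_stone_space
      by (rule restrict_ext)
        (auto simp: ultrafilter_preimage[OF C.ba D.ba iBa_homD(1)[OF g]] iBa_homD(4)[OF f])
  qed
  ultimately show ?thesis
    by (intro is_contravariant_functorI is_category_zdK is_category_iBa)
      (simp_all add: split_paired_all S_star_ob S_star_hom)
qed

section \<open>The units of Stone duality\<close>

lemma boolean_space_separated:
  assumes X: "boolean_space X" and xy: "x \<in> topspace X" "y \<in> topspace X" "x \<noteq> y"
  obtains U where "openin X U" "closedin X U" "x \<in> U" "y \<notin> U"
proof -
  obtain W where "openin X W" "x \<in> W" "y \<notin> W"
    using X xy unfolding boolean_space_def Hausdorff_space_def disjnt_def by blast
  then show ?thesis
    using X that unfolding boolean_space_def neighbourhood_base_of by blast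
qed

text \<open>Injectivity is clopen separation. For surjectivity, an ultrafilter \<open>u\<close> of
  clopen sets has the finite intersection property, so compactness yields a point \<open>x\<close>
  in all its members; then \<open>u\<close> is contained in \<open>clop_at X x\<close>, and
  maximality gives equality.\<close>

lemma homeomorphic_map_clop_at:
  assumes X: "boolean_space X"
  shows "homeomorphic_map X (stone_space (clop X)) (\<lambda>x\<in>topspace X. clop_at X x)" (is "homeomorphic_map _ _ ?\<eta>")
proof (rule continuous_imp_homeomorphic_map)
  interpret bool_alg "clop X" by unfold_locales (rule boolean_alg_clop)
  show "compact_space X" using X by (simp add: boolean_space_def)
  show "Hausdorff_space (stone_space (clop X))" by (rule Hausdorff_stone_space)
  show "continuous_map X (stone_space (clop X)) ?\<eta>"
    unfolding stone_space_def
  proof (rule continuous_on_generated_topo)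
    show "?\<eta> ` topspace X
        \<subseteq> \<Union>{{u. ultrafilter_of (clop X) u \<and> b \<in> u} | b. b \<in> carr (clop X)}"
    proof
      fix u assume "u \<in> ?\<eta> ` topspace X"
      then have "ultrafilter_of (clop X) u" using ultrafilter_clop_at by auto
      then show "u \<in> \<Union>{{u. ultrafilter_of (clop X) u \<and> b \<in> u} | b. b \<in> carr (clop X)}"
        using ultrafilter_topp topp_closed by blast
    qed
    fix U assume "U \<in> {{u. ultrafilter_of (clop X) u \<and> b \<in> u} | b. b \<in> carr (clop X)}"
    then obtain b where b: "b \<in> carr (clop X)" "U = {u. ultrafilter_of (clop X) u \<and> b \<in> u}" by blast
    then have "?\<eta> -` U \<inter> topspace X = b"
      using ultrafilter_clop_at openin_subset[of X b] by (auto simp: clop_at_def)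
    then show "openin X (?\<eta> -` U \<inter> topspace X)" using b by simp
  qed
  show "inj_on ?\<eta> (topspace X)"
  proof (rule inj_onI, rule ccontr)
    fix x y assume xy: "x \<in> topspace X" "y \<in> topspace X" "x \<noteq> y" and "?\<eta> x = ?\<eta> y"
    then show False
      using boolean_space_separated[OF X xy] by (auto simp: clop_at_def)
  qed
  show "?\<eta> ` topspace X = topspace (stone_space (clop X))"
  proof
    show "?\<eta> ` topspace X \<subseteq> topspace (stone_space (clop X))"
      using ultrafilter_clop_at by (auto simp: topspace_stone_space)
    show "topspace (stone_space (clop X)) \<subseteq> ?\<eta> ` topspace X"
    proof
      fix u assume "u \<in> topspace (stone_space (clop X))"
      then have u: "ultrafilter_of (clop X) u" by (simp add: topspace_stone_space)
      have clo: "\<And>C. C \<in> u \<Longrightarrow> closedin X C" using ultrafilter_subset[OF u] by auto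
      \<comment> \<open>The empty family is excluded because its intersection is
        \<open>UNIV\<close>, which need not lie in \<open>u\<close>.\<close>
      have fin: "\<Inter>\<F> \<in> u" if "finite \<F>" "\<F> \<noteq> {}" "\<F> \<subseteq> u" for \<F>
        using that
      proof (induction rule: finite_ne_induct)
        case (insert C \<F>)
        then have "C \<in> u" "\<Inter>\<F> \<in> u" by auto
        then show ?case
          using ultrafilter_meet[OF u, of C "\<Inter>\<F>"] ultrafilter_subset[OF u] by auto
      qed auto
      have "{} \<notin> u" using ultrafilter_bott[OF u] by simp
      have "\<Inter>\<F> \<noteq> {}" if "finite \<F>" "\<F> \<subseteq> u" for \<F>
        using fin[OF that(1) _ that(2)] \<open>{} \<notin> u\<close> by (cases "\<F> = {}") auto
      then have "\<Inter>u \<noteq> {}"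
        using X[unfolded boolean_space_def compact_space_fip, THEN conjunct1, THEN spec, of u] clo by simp
      then obtain x where x: "x \<in> \<Inter>u" by blast
      then have xX: "x \<in> topspace X" using ultrafilter_topp[OF u] by auto
      have "u \<subseteq> clop_at X x" using x ultrafilter_subset[OF u] by (auto simp: clop_at_def)
      moreover have "lattice_filter (clop X) (clop_at X x)" "clop_at X x \<noteq> carr (clop X)"
        using ultrafilter_clop_at[OF xX] by (simp_all add: ultrafilter_of_def)
      ultimately have "clop_at X x = u" using u unfolding ultrafilter_of_def by blast
      then show "u \<in> ?\<eta> ` topspace X" using xX by force
    qed
  qed
qed

lemma contra_left_quasi_inverse_S_star_IB:
  "contra_left_quasi_inverse (zdK :: ('a pspace, 'a) concrete_cat) iBa
     (zdK :: ('a set set pspace, 'a set set) concrete_cat) zdK_hom zdK_hom S_star IB"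
proof -
  define \<eta> :: "'a pspace \<Rightarrow> 'a \<Rightarrow> 'a set set" where
    "\<eta> X = (\<lambda>x\<in>topspace (fst X). clop_at (fst X) x)" for X
  have pt: "carr (clop X) - {b \<in> carr (clop X). p \<notin> b} = clop_at X p" for X :: "'a topology" and p
    by (auto simp: clop_at_def)
  have "is_iso (topspace X) (topspace (stone_space (clop X)))
      (zdK_hom (X, p) (stone_space (clop X), clop_at X p))
      (zdK_hom (stone_space (clop X), clop_at X p) (X, p)) (\<eta> (X, p))"
    if X: "boolean_space X" and p: "p \<in> topspace X" for X :: "'a topology" and p
  proof -
    let ?g = "inv_into (topspace X) (\<eta> (X, p))"
    let ?S = "stone_space (clop X)"
    have hm: "homeomorphic_map X ?S (\<eta> (X, p))"
      using homeomorphic_map_clop_at[OF X] by (simp add: \<eta>_def)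
    then have im: "\<eta> (X, p) ` topspace X = topspace ?S" and inj: "inj_on (\<eta> (X, p)) (topspace X)"
      by (simp_all add: homeomorphic_imp_surjective_map homeomorphic_imp_injective_map)
    then have bij: "bij_betw (\<eta> (X, p)) (topspace X) (topspace ?S)" by (simp add: bij_betw_def)
    have hom: "\<eta> (X, p) \<in> zdK_hom (X, p) (?S, clop_at X p)"
      using homeomorphic_imp_continuous_map[OF hm] im p by (auto simp: zdK_hom_def \<eta>_def)
    obtain g where g: "homeomorphic_maps X ?S (\<eta> (X, p)) g"
      using hm homeomorphic_map_maps by blast
    then have gc: "continuous_map ?S X g" and ge: "\<And>u. u \<in> topspace ?S \<Longrightarrow> \<eta> (X, p) (g u) = u"
      unfolding homeomorphic_maps_def by auto
    \<comment> \<open>\<open>is_isoI\<close> asks for \<open>inv_into\<close>; agreement with the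
      continuous inverse \<open>g\<close> on the space makes it continuous as well.\<close>
    have "g u = ?g u" if u: "u \<in> topspace ?S" for u
    proof -
      have "g u \<in> topspace X" using continuous_map_image_subset_topspace[OF gc] u by blast
      then have "?g (\<eta> (X, p) (g u)) = g u" by (rule inv_into_f_f[OF inj])
      then show ?thesis using ge[OF u] by simp
    qed
    then have "continuous_map ?S X (restrict ?g (topspace ?S))"
      by (intro continuous_map_eq[OF gc]) simp
    moreover have "\<eta> (X, p) p = clop_at X p" using p by (simp add: \<eta>_def)
    then have "?g (clop_at X p) = p" "clop_at X p \<in> topspace ?S"
      using inv_into_f_f[OF inj p] p im by auto
    ultimately have "restrict ?g (topspace ?S) \<in> zdK_hom (?S, clop_at X p) (X, p)"
      using im by (auto simp: zdK_hom_def inv_into_into)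
    with hom bij show ?thesis by (rule is_isoI)
  qed
  moreover have "compose (topspace X) (\<eta> (Y, q)) f = compose (topspace X)
     (\<lambda>u\<in>{u. ultrafilter_of (clop X) u}. {b \<in> carr (clop Y). (\<lambda>b\<in>carr (clop Y). {x \<in> topspace X. f x \<in> b}) b \<in> u})
     (\<eta> (X, p))"
    if p: "p \<in> topspace X" and f: "f \<in> zdK_hom (X, p) (Y, q)" for X Y :: "'a topology" and p q f
  proof -
    \<comment> \<open>As preimages of clopen sets are clopen, both sides at \<open>x\<close> are the
      set of clopen \<open>b\<close> with \<open>f x \<in> b\<close>.\<close>
    have "openin X {x \<in> topspace X. f x \<in> b}" "closedin X {x \<in> topspace X. f x \<in> b}"
      if "openin Y b" "closedin Y b" for b
      using that zdK_homD(2)[OF f]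
      by (auto intro: openin_continuous_map_preimage closedin_continuous_map_preimage)
    then show ?thesis
      unfolding compose_def
      by (intro restrict_ext) (auto simp: \<eta>_def ultrafilter_clop_at[unfolded clop_at_def] zdK_homD(4)[OF f] clop_at_def)
  qed
  ultimately have "naturally_isomorphic (zdK :: ('a pspace, 'a) concrete_cat) zdK zdK zdK_hom zdK_hom id_fctr (comp_contra S_star IB)"
    by (intro naturally_isomorphicI[where \<eta> = \<eta>])
      (simp_all add: split_paired_all zdK_ob_def pt del: clop_sel)
  then show ?thesis
    using is_contravariant_functor_IB is_contravariant_functor_S_star
    unfolding contra_left_quasi_inverse_def by blast
qed

text \<open>The unit is the Stone representation: injective by separation, onto the clopen sets by
  compactness. At \<open>b\<close>, both sides of the naturality square are the set of ultrafilters
  \<open>u\<close> with \<open>f b \<in> u\<close>.\<close>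

lemma contra_left_quasi_inverse_IB_S_star:
  "contra_left_quasi_inverse (iBa :: ('b ibalg, 'b) concrete_cat) zdK
     (iBa :: ('b set set ibalg, 'b set set) concrete_cat) iBa_hom iBa_hom IB S_star"
proof -
  define \<eta> :: "'b ibalg \<Rightarrow> 'b \<Rightarrow> 'b set set" where
    "\<eta> X = restrict (stone_open (fst X)) (carr (fst X))" for X
  have "is_iso (carr B) (carr (clop (stone_space B)))
      (iBa_hom (B, I) (clop (stone_space B), {b \<in> carr (clop (stone_space B)). carr B - I \<notin> b}))
      (iBa_hom (clop (stone_space B), {b \<in> carr (clop (stone_space B)). carr B - I \<notin> b}) (B, I))
      (\<eta> (B, I))"
    if ob: "(B, I) \<in> iBa_ob" for B :: "'b balg" and I
  proof (rule is_iso_iBa[OF ob])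
    interpret idealized_bool_alg B I using ob by (rule iBa_obD)
    show "(clop (stone_space B), {b \<in> carr (clop (stone_space B)). carr B - I \<notin> b}) \<in> iBa_ob"
      using S_star_ob[OF ob] by (intro IB_ob) (simp add: zdK_ob_def)
    show "bij_betw (\<eta> (B, I)) (carr B) (carr (clop (stone_space B)))"
      unfolding carr_clop_stone_space \<eta>_def using stone_open_inj
      by (auto simp: bij_betw_def inj_on_def)
    have [simp]: "stone_open B b \<in> carr (clop (stone_space B))" if "b \<in> carr B" for b
      using that by (simp only: carr_clop_stone_space) blast
    show "\<eta> (B, I) \<in>
        iBa_hom (B, I) (clop (stone_space B), {b \<in> carr (clop (stone_space B)). carr B - I \<notin> b})"
    proof (rule iBa_homI)
      show "\<eta> (B, I) \<in> lattice_bot_hom B (clop (stone_space B))"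
        by (rule lattice_bot_homI) (auto simp: \<eta>_def stone_open_ops simp del: clop_sel(1))
      fix a assume a: "a \<in> carr B"
      have "carr B - I \<in> stone_open B a \<longleftrightarrow> a \<notin> I"
        using a ultrafilter_Compl by (simp add: stone_open_def)
      then show "\<eta> (B, I) a \<in> {b \<in> carr (clop (stone_space B)). carr B - I \<notin> b} \<longleftrightarrow> a \<in> I"
        using a by (simp add: \<eta>_def del: clop_sel(1))
    qed (auto simp: \<eta>_def stone_open_ops topspace_stone_space)
  qed
  moreover have "compose (carr B) (\<eta> (C, J)) f = compose (carr B)
      (\<lambda>W\<in>carr (clop (stone_space B)). {u \<in> topspace (stone_space C).
          (\<lambda>u\<in>{u. ultrafilter_of C u}. {b \<in> carr B. f b \<in> u}) u \<in> W}) (\<eta> (B, I))"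
    if "(B, I) \<in> iBa_ob" "(C, J) \<in> iBa_ob" and f: "f \<in> iBa_hom (B, I) (C, J)"
    for B C :: "'b balg" and I J f
  proof -
    interpret B: idealized_bool_alg B I using that(1) by (rule iBa_obD)
    interpret C: idealized_bool_alg C J using that(2) by (rule iBa_obD)
    have uf: "ultrafilter_of B {b \<in> carr B. f b \<in> u}" if "ultrafilter_of C u" for u
      using ultrafilter_preimage[OF B.ba C.ba iBa_homD(1)[OF f] that] .
    show ?thesis
      unfolding compose_def B.carr_clop_stone_space C.topspace_stone_space
      by (intro restrict_ext) (auto simp: \<eta>_def iBa_homD(4)[OF f] stone_open_def uf)
  qed
  ultimately have "naturally_isomorphic (iBa :: ('b ibalg, 'b) concrete_cat) iBa iBa iBa_hom iBa_hom id_fctr (comp_contra IB S_star)"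
    by (intro naturally_isomorphicI[where \<eta> = \<eta>]) (simp_all add: split_paired_all del: clop_sel)
  then show ?thesis
    using is_contravariant_functor_IB is_contravariant_functor_S_star
    unfolding contra_left_quasi_inverse_def by blast
qed

theorem theorem7p1p5:
  shows
    "contra_left_quasi_inverse
       (zdK :: ('a pspace, 'a) concrete_cat) (iBa :: ('a set ibalg, 'a set) concrete_cat)
       (zdK :: ('a set set pspace, 'a set set) concrete_cat) zdK_hom zdK_hom S_star IB \<and>
     contra_left_quasi_inverse
       (iBa :: ('b ibalg, 'b) concrete_cat) (zdK :: ('b set pspace, 'b set) concrete_cat)
       (iBa :: ('b set set ibalg, 'b set set) concrete_cat) iBa_hom iBa_hom IB S_star \<and>
     left_quasi_inverse
       (iBa :: ('c ibalg, 'c) concrete_cat) (gBa :: ('c glat, 'c) concrete_cat)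
       (iBa :: (('c + 'c) ibalg, 'c + 'c) concrete_cat) iBa_hom iBa_hom B_fctr F_fctr \<and>
     left_quasi_inverse
       (gBa :: ('d glat, 'd) concrete_cat) (iBa :: (('d + 'd) ibalg, 'd + 'd) concrete_cat)
       (gBa :: (('d + 'd) glat, 'd + 'd) concrete_cat) lattice_bot_hom lattice_bot_hom
       F_fctr B_fctr"
  using contra_left_quasi_inverse_S_star_IB contra_left_quasi_inverse_IB_S_star
    left_quasi_inverse_B_F left_quasi_inverse_F_B by blast

end
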